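(* The time-changed $Q$-Wiener process $W_{E_t}=\sum_{j=1}^{\infty}\lambda_j^{1/2}w_j(E_t)f_j$ is a $K$-valued square integrable martingale with respect to the filtration $\mathcal{G}_t:=\tilde{\mathcal{F}}_{E_t}$.
   Context: $K$ is a real separable Hilbert space, $Q$ a nonnegative definite, symmetric, trace-class operator on $K$, $\{f_j\}_{j\ge1}$ an orthonormal basis of $K$ diagonalizing $Q$, with eigenvalues $Qf_j=\lambda_jf_j$. On a probability space $(\Omega,\mathcal F,\mathbb P)$, $\{w_j(t)\}_{t\ge0}$, $j=1,2,\dots$, are independent standard real Brownian motions. For $\beta\in(0,1)$, $U_\beta$ is a $\beta$-stable subordinator with $\mathbb E(e^{-uU_\beta(\tau)})=e^{-\tau u^\beta}$, and $E_t=\inf\{\tau>0:U_\beta(\tau)>t\}$ is its inverse; the Brownian motions $w_j$ are independent of $E$. The filtration is $\tilde{\mathcal F}_t=\bigcap_{u>t}\{\sigma[w_j(s):0\le s\le u,\ j=1,2,\dots]\vee\sigma[E_s:s\ge0]\}$, with $\tilde{\mathcal F}_0$ assumed complete; $\tilde{\mathcal F}_{E_t}$ is the $\sigma$-field at the $\tilde{\mathcal F}$-stopping time $E_t$. A $K$-valued process $M_t$, $t\le T$, adapted to a filtration $\{\mathcal H_t\}_{t\le T}$ with $\mathbb E\|M_t\|_K<\infty$ is an $\mathcal H_t$-martingale if $\mathbb E(M_t\mid\mathcal H_s)=M_s$ $\mathbb P$-a.s. for all $0\le s\le t$; it is square integrable on $0\le t\le T$ if $\mathbb E\|M_T\|_K^2<\infty$.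 Here $T>0$ is an arbitrary fixed time. *)

theory Defs
  imports "HOL-Probability.Probability"
begin

section \<open>Operators on a Hilbert space\<close>

definition orthonormal_basis :: "'k::real_inner set \<Rightarrow> bool" where
  "orthonormal_basis B \<longleftrightarrow>
     pairwise orthogonal B \<and> (\<forall>e\<in>B. norm e = 1) \<and> closure (span B) = UNIV"

definition symmetric_op :: "('k::real_inner \<Rightarrow> 'k) \<Rightarrow> bool" where
  "symmetric_op A \<longleftrightarrow> (\<forall>x y. A x \<bullet> y = x \<bullet> A y)"

definition nonneg_definite :: "('k::real_inner \<Rightarrow> 'k) \<Rightarrow> bool" where
  "nonneg_definite A \<longleftrightarrow> (\<forall>x. 0 \<le> A x \<bullet> x)"

text \<open>In \<open>trace_class\<close>, \<open>R\<close> is the absolute value \<open>(A\<^sup>*A)\<^sup>1\<^sup>/\<^sup>2\<close> of \<open>A\<close>, i.e. the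
  (unique) nonnegative symmetric square root of \<open>A\<^sup>*A\<close>.\<close>

definition trace_class :: "('k::real_inner \<Rightarrow> 'k) \<Rightarrow> bool" where
  "trace_class A \<longleftrightarrow> bounded_linear A \<and>
     (\<exists>R. bounded_linear R \<and> symmetric_op R \<and> nonneg_definite R \<and>
          R \<circ> R = adjoint A \<circ> A \<and>
          (\<forall>B. orthonormal_basis B \<longrightarrow> (\<lambda>e. R e \<bullet> e) summable_on B))"


section \<open>Brownian motion, subordinators and their inverses\<close>

text \<open>Processes are indexed by \<open>real\<close>, but only their values at times \<open>t \<ge> 0\<close> matter.
  Path properties are required almost surely.\<close>

definition independent_increments :: "'a measure \<Rightarrow> (real \<Rightarrow> 'a \<Rightarrow> real) \<Rightarrow> bool" where
  "independent_increments M X \<longleftrightarrow>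
     (\<forall>(t :: nat \<Rightarrow> real) n. 0 \<le> t 0 \<and> mono t \<longrightarrow>
        prob_space.indep_vars M (\<lambda>_. borel) (\<lambda>i \<omega>. X (t (Suc i)) \<omega> - X (t i) \<omega>) {..<n})"

definition standard_brownian_motion :: "'a measure \<Rightarrow> (real \<Rightarrow> 'a \<Rightarrow> real) \<Rightarrow> bool" where
  "standard_brownian_motion M w \<longleftrightarrow>
     (\<forall>t\<ge>0. w t \<in> borel_measurable M) \<and>
     (AE \<omega> in M. w 0 \<omega> = 0) \<and>
     independent_increments M w \<and>
     (\<forall>s t. 0 \<le> s \<and> s < t \<longrightarrow>
        distributed M lborel (\<lambda>\<omega>. w t \<omega> - w s \<omega>) (normal_density 0 (sqrt (t - s)))) \<and>
     (AE \<omega> in M. continuous_on {0..} (\<lambda>t. w t \<omega>))"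

definition subordinator :: "'a measure \<Rightarrow> (real \<Rightarrow> 'a \<Rightarrow> real) \<Rightarrow> bool" where
  "subordinator M U \<longleftrightarrow>
     (\<forall>\<tau>\<ge>0. U \<tau> \<in> borel_measurable M) \<and>
     (AE \<omega> in M. U 0 \<omega> = 0) \<and>
     independent_increments M U \<and>
     (\<forall>\<sigma>\<ge>0. \<forall>\<tau>\<ge>0. distr M borel (\<lambda>\<omega>. U (\<sigma> + \<tau>) \<omega> - U \<sigma> \<omega>) = distr M borel (U \<tau>)) \<and>
     (AE \<omega> in M. mono_on {0..} (\<lambda>\<tau>. U \<tau> \<omega>) \<and>
                 (\<forall>\<tau>\<ge>0. continuous (at_right \<tau>) (\<lambda>r. U r \<omega>)))"

definition stable_subordinator :: "'a measure \<Rightarrow> real \<Rightarrow> (real \<Rightarrow> 'a \<Rightarrow> real) \<Rightarrow> bool" where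
  "stable_subordinator M \<beta> U \<longleftrightarrow> subordinator M U \<and>
     (\<forall>u\<ge>0. \<forall>\<tau>\<ge>0. (\<integral>\<omega>. exp (- u * U \<tau> \<omega>) \<partial>M) = exp (- \<tau> * u powr \<beta>))"

text \<open>The set below is nonempty almost surely for a stable subordinator; on the exceptional
  null set the value is irrelevant.\<close>

definition inverse_subordinator :: "(real \<Rightarrow> 'a \<Rightarrow> real) \<Rightarrow> real \<Rightarrow> 'a \<Rightarrow> real" where
  "inverse_subordinator U t \<omega> = Inf {\<tau>. 0 < \<tau> \<and> t < U \<tau> \<omega>}"

text \<open>Independence of whole processes is independence of the random elements
  \<open>\<omega> \<mapsto> (X\<^sub>t(\<omega>))\<^sub>t\<close> of a product space with its product \<open>\<sigma>\<close>-algebra.\<close>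

definition independent_processes :: "'a measure \<Rightarrow> (nat \<Rightarrow> real \<Rightarrow> 'a \<Rightarrow> real) \<Rightarrow> bool" where
  "independent_processes M w \<longleftrightarrow>
     prob_space.indep_vars M (\<lambda>_. PiM {0..} (\<lambda>_. borel)) (\<lambda>j \<omega>. \<lambda>t\<in>{0..}. w j t \<omega>) UNIV"

definition family_independent_of ::
    "'a measure \<Rightarrow> (nat \<Rightarrow> real \<Rightarrow> 'a \<Rightarrow> real) \<Rightarrow> (real \<Rightarrow> 'a \<Rightarrow> real) \<Rightarrow> bool" where
  "family_independent_of M w E \<longleftrightarrow>
     prob_space.indep_set M
       (sets (vimage_algebra (space M) (\<lambda>\<omega>. \<lambda>(j, t)\<in>UNIV \<times> {0..}. w j t \<omega>)
                (PiM (UNIV \<times> {0..}) (\<lambda>_. borel))))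
       (sets (vimage_algebra (space M) (\<lambda>\<omega>. \<lambda>t\<in>{0..}. E t \<omega>) (PiM {0..} (\<lambda>_. borel))))"


section \<open>The filtrations\<close>

text \<open>\<open>bm_sigma M w E u\<close> is \<open>\<sigma>[w\<^sub>j(s) : 0 \<le> s \<le> u, j] \<or> \<sigma>[E\<^sub>s : s \<ge> 0]\<close>, augmented by the null
  sets of \<open>M\<close>. The augmentation renders the convention that the \<open>\<sigma>\<close>-field at time \<open>0\<close> is
  complete: if \<open>M\<close> is complete, \<open>tilde_F M w E 0\<close> contains every subset of every null set.
  Augmenting before or after taking the intersection over \<open>u > t\<close> gives the same \<open>\<sigma>\<close>-field.\<close>

definition bm_sigma ::
    "'a measure \<Rightarrow> (nat \<Rightarrow> real \<Rightarrow> 'a \<Rightarrow> real) \<Rightarrow> (real \<Rightarrow> 'a \<Rightarrow> real) \<Rightarrow> real \<Rightarrow> 'a measure" where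
  "bm_sigma M w E u = sigma (space M)
     ({w j s -` B \<inter> space M | j s B. 0 \<le> s \<and> s \<le> u \<and> B \<in> sets borel} \<union>
      {E s -` B \<inter> space M | s B. 0 \<le> s \<and> B \<in> sets borel} \<union>
      null_sets M)"

definition tilde_F ::
    "'a measure \<Rightarrow> (nat \<Rightarrow> real \<Rightarrow> 'a \<Rightarrow> real) \<Rightarrow> (real \<Rightarrow> 'a \<Rightarrow> real) \<Rightarrow> real \<Rightarrow> 'a measure" where
  "tilde_F M w E t = sigma (space M) (\<Inter>u\<in>{t<..}. sets (bm_sigma M w E u))"

text \<open>\<open>filtration.pre_sigma\<close> also tests the sets \<open>A \<inter> {E\<^sub>t \<le> r}\<close> for \<open>r < 0\<close>. This imposes nothing
  new when \<open>M\<close> is complete: these are null sets, hence in \<open>tilde_F M w E r\<close>.\<close>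

definition time_changed_filtration ::
    "'a measure \<Rightarrow> (nat \<Rightarrow> real \<Rightarrow> 'a \<Rightarrow> real) \<Rightarrow> (real \<Rightarrow> 'a \<Rightarrow> real) \<Rightarrow> real \<Rightarrow> 'a measure" where
  "time_changed_filtration M w E t = filtration.pre_sigma (space M) (tilde_F M w E) (E t)"


section \<open>The time-changed Wiener process\<close>

text \<open>The series converges almost surely in norm at every time \<open>t \<ge> 0\<close>, and also along the time
  change, since \<open>\<Sum>\<^sub>j \<lambda>\<^sub>j w\<^sub>j(t)\<^sup>2 < \<infinity>\<close> almost surely.\<close>

definition Q_wiener ::
    "(nat \<Rightarrow> real) \<Rightarrow> (nat \<Rightarrow> real \<Rightarrow> 'a \<Rightarrow> real) \<Rightarrow> (nat \<Rightarrow> 'k::real_normed_vector) \<Rightarrow>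
     real \<Rightarrow> 'a \<Rightarrow> 'k" where
  "Q_wiener l w f t \<omega> = (\<Sum>j. (sqrt (l j) * w j t \<omega>) *\<^sub>R f j)"

definition time_change :: "(real \<Rightarrow> 'a \<Rightarrow> 'k) \<Rightarrow> (real \<Rightarrow> 'a \<Rightarrow> real) \<Rightarrow> real \<Rightarrow> 'a \<Rightarrow> 'k" where
  "time_change W E t \<omega> = W (E t \<omega>) \<omega>"


section \<open>Vector-valued martingales\<close>

text \<open>\<open>is_cond_exp M F X Y\<close>: \<open>Y\<close> is a version of the conditional expectation of \<open>X\<close> given \<open>F\<close>.
  (The conditional expectation of the library is restricted to real-valued functions.)\<close>

definition is_cond_exp ::
    "'a measure \<Rightarrow> 'a measure \<Rightarrow> ('a \<Rightarrow> 'k::{banach, second_countable_topology}) \<Rightarrow>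
     ('a \<Rightarrow> 'k) \<Rightarrow> bool" where
  "is_cond_exp M F X Y \<longleftrightarrow>
     integrable M X \<and> integrable M Y \<and> Y \<in> borel_measurable F \<and>
     (\<forall>A\<in>sets F. (LINT \<omega>:A|M. Y \<omega>) = (LINT \<omega>:A|M. X \<omega>))"

definition filtration_upto :: "'a measure \<Rightarrow> real \<Rightarrow> (real \<Rightarrow> 'a measure) \<Rightarrow> bool" where
  "filtration_upto M T H \<longleftrightarrow>
     (\<forall>t\<in>{0..T}. subalgebra M (H t)) \<and>
     (\<forall>s t. 0 \<le> s \<and> s \<le> t \<and> t \<le> T \<longrightarrow> sets (H s) \<subseteq> sets (H t))"

definition martingale_upto ::
    "'a measure \<Rightarrow> real \<Rightarrow> (real \<Rightarrow> 'a measure) \<Rightarrow>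
     (real \<Rightarrow> 'a \<Rightarrow> 'k::{banach, second_countable_topology}) \<Rightarrow> bool" where
  "martingale_upto M T H X \<longleftrightarrow>
     filtration_upto M T H \<and>
     (\<forall>t\<in>{0..T}. X t \<in> borel_measurable (H t) \<and> integrable M (X t)) \<and>
     (\<forall>s t. 0 \<le> s \<and> s \<le> t \<and> t \<le> T \<longrightarrow>
        (\<exists>Y. is_cond_exp M (H s) (X t) Y \<and> (AE \<omega> in M. Y \<omega> = X s \<omega>)))"

definition square_integrable_martingale_upto ::
    "'a measure \<Rightarrow> real \<Rightarrow> (real \<Rightarrow> 'a measure) \<Rightarrow>
     (real \<Rightarrow> 'a \<Rightarrow> 'k::{banach, second_countable_topology}) \<Rightarrow> bool" where
  "square_integrable_martingale_upto M T H X \<longleftrightarrow>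
     martingale_upto M T H X \<and> integrable M (\<lambda>\<omega>. (norm (X T \<omega>))\<^sup>2)"

end

theory Submission
  imports Defs
begin

text \<open>
  The Brownian motions are evaluated at times that are independent of them, and the filtration contains the
  whole clock \<open>E\<close> from the beginning. Hence \<open>E\<^sub>t\<close> is a stopping time, and the increment \<open>w\<^sub>j(b) - w\<^sub>j(u)\<close> is
  independent not only of the past of \<open>w\<^sub>j\<close> but of the whole \<open>\<sigma>\<close>-field at time \<open>u\<close>
  (\<open>increment_indep_BM\<close>). Thus every \<open>w\<^sub>j\<close> remains a Brownian motion in the enlarged filtration, and the
  martingale property of \<open>w\<^sub>j(E\<^sub>t)\<close> is a case of optional sampling.

  The sampling argument is carried out by discretization. The clock is moved to the next dyadic grid point
  strictly above it. An event of the \<open>\<sigma>\<close>-field at \<open>E\<^sub>s\<close> is then cut into countably many pieces, each lying in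
  the past of a deterministic time \<open>a\<close>, on which the increment runs from \<open>a\<close> to another deterministic time
  \<open>b\<close>; there its integral is \<open>0\<close>, and the integral of its square is \<open>b - a\<close> times the probability of the piece
  (\<open>grid_sampling\<close>). The second moments show that the discretization error is at most \<open>2\<^sup>-\<^sup>n\<close> in mean
  square (\<open>w_grid_L2\<close>) and that \<open>w\<^sub>j(E\<^sub>t)\<close> has second moment at most one more than the mean of \<open>E\<^sub>t\<close>
  (\<open>w_clock_second_moment\<close>); the first moments give the martingale identity (\<open>w_clock_martingale\<close>).

  Two facts make the argument applicable. The inverse \<open>E\<^sub>t\<close> of the subordinator is integrable, because it is
  at most \<open>\<Sum>\<^sub>n exp (t - U\<^sub>n)\<close>, whose expectation is a geometric series by the formula for the Laplace transform
  (\<open>inverse_stable_subordinator_integrable\<close>). The eigenvalues of the trace-class operator are summable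
  (\<open>trace_class_eigenvalues_summable\<close>), so that \<open>\<Sum>\<^sub>j l\<^sub>j w\<^sub>j(E\<^sub>t)\<^sup>2\<close> is integrable; this gives almost sure
  convergence of the series and its square integrability, and the martingale identity carries over from the
  coordinates to the Hilbert space.
\<close>

section \<open>Trace-class operators and orthonormal series\<close>

lemma orthonormal_sequence_inner:
  fixes f :: "nat \<Rightarrow> 'k::real_inner"
  assumes "inj f" and "orthonormal_basis (range f)"
  shows "f i \<bullet> f j = (if i = j then 1 else 0)"
proof (cases "i = j")
  case True
  have "norm (f i) = 1"
    using assms(2) by (auto simp: orthonormal_basis_def)
  then show ?thesis
    using True by (simp add: dot_square_norm)
next
  case False
  then have "f i \<noteq> f j"
    using assms(1) by (auto dest: injD)
  then show ?thesis
    using assms(2) False unfolding orthonormal_basis_def pairwise_def orthogonal_def by auto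
qed

text \<open>The vectors orthogonal to \<open>x - y\<close> form a closed subspace. If it contains the basis, it is the whole
  space, and then \<open>x - y\<close> is orthogonal to itself.\<close>

lemma eq_if_inner_orthonormal_basis_eq:
  fixes f :: "nat \<Rightarrow> 'k::real_inner"
  assumes basis: "orthonormal_basis (range f)" and eq: "\<And>k. x \<bullet> f k = y \<bullet> f k"
  shows "x = y"
proof -
  define N where "N = {z. (x - y) \<bullet> z = 0}"
  have "closed N"
    unfolding N_def by (intro closed_Collect_eq continuous_intros)
  moreover have "span (range f) \<subseteq> N"
  proof (rule span_minimal)
    show "range f \<subseteq> N"
      using eq by (auto simp: N_def inner_diff_left)
    show "subspace N"
      by (auto simp: N_def subspace_def inner_add_right)
  qed
  ultimately have "closure (span (range f)) \<subseteq> N"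
    by (intro closure_minimal)
  then have "x - y \<in> N"
    using basis by (auto simp: orthonormal_basis_def)
  then show ?thesis
    by (simp add: N_def)
qed

lemma norm_square_orthonormal_sum:
  fixes f :: "nat \<Rightarrow> 'k::real_inner"
  assumes "\<And>i j. f i \<bullet> f j = (if i = j then 1 else 0)" and "finite I"
  shows "(norm (\<Sum>j\<in>I. c j *\<^sub>R f j))\<^sup>2 = (\<Sum>j\<in>I. (c j)\<^sup>2)"
proof -
  have "(norm (\<Sum>j\<in>I. c j *\<^sub>R f j))\<^sup>2 = (\<Sum>j\<in>I. \<Sum>i\<in>I. (c j *\<^sub>R f j) \<bullet> (c i *\<^sub>R f i))"
    unfolding power2_norm_eq_inner inner_sum_left[of _ I] by (intro sum.cong refl inner_sum_right)
  also have "\<dots> = (\<Sum>j\<in>I. \<Sum>i\<in>I. if j = i then c j * c i else 0)"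
    by (intro sum.cong refl) (auto simp: assms(1))
  also have "\<dots> = (\<Sum>j\<in>I. (c j)\<^sup>2)"
    using assms(2) by (simp add: power2_eq_square)
  finally show ?thesis .
qed

text \<open>By Pythagoras the partial sums of the vector series are Cauchy as soon as those of the squared
  coefficients are. Inner products and squared norms of the partial sums then pass to the limit.\<close>

lemma orthonormal_series:
  fixes f :: "nat \<Rightarrow> 'k::{real_inner, banach}"
  assumes orth: "\<And>i j. f i \<bullet> f j = (if i = j then 1 else 0)"
    and square_summable: "summable (\<lambda>j. (c j)\<^sup>2)"
  shows "summable (\<lambda>j. c j *\<^sub>R f j)"
    and "(\<Sum>j. c j *\<^sub>R f j) \<bullet> f k = c k"
    and "(norm (\<Sum>j. c j *\<^sub>R f j))\<^sup>2 = (\<Sum>j. (c j)\<^sup>2)"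
proof -
  show summ: "summable (\<lambda>j. c j *\<^sub>R f j)"
    unfolding summable_Cauchy
  proof (intro allI impI)
    fix e :: real assume "0 < e"
    then obtain N where N: "\<And>m n. N \<le> m \<Longrightarrow> norm (\<Sum>j = m..<n. (c j)\<^sup>2) < e\<^sup>2"
      using square_summable unfolding summable_Cauchy by (meson zero_less_power)
    have "norm (\<Sum>j = m..<n. c j *\<^sub>R f j) < e" if "N \<le> m" for m n
    proof -
      have "(norm (\<Sum>j = m..<n. c j *\<^sub>R f j))\<^sup>2 < e\<^sup>2"
        using N[OF that, of n] norm_square_orthonormal_sum[OF orth, of "{m..<n}" c]
        by (simp add: sum_nonneg)
      then show ?thesis
        using \<open>0 < e\<close> by (simp add: power_less_imp_less_base)
    qed
    then show "\<exists>N. \<forall>m\<ge>N. \<forall>n. norm (\<Sum>j = m..<n. c j *\<^sub>R f j) < e"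
      by blast
  qed
  have "(\<lambda>j. (c j *\<^sub>R f j) \<bullet> f k) sums ((\<Sum>j. c j *\<^sub>R f j) \<bullet> f k)"
    by (rule bounded_linear.sums[OF bounded_linear_inner_left summable_sums[OF summ]])
  moreover have "(\<lambda>j. (c j *\<^sub>R f j) \<bullet> f k) sums c k"
    using sums_single[of k c] by (simp add: orth if_distrib cong: if_cong)
  ultimately show "(\<Sum>j. c j *\<^sub>R f j) \<bullet> f k = c k"
    by (rule sums_unique2)
  have "(\<lambda>n. (norm (\<Sum>j<n. c j *\<^sub>R f j))\<^sup>2) \<longlonglongrightarrow> (norm (\<Sum>j. c j *\<^sub>R f j))\<^sup>2"
    by (intro tendsto_intros summable_LIMSEQ summ)
  moreover have "(\<lambda>n. (norm (\<Sum>j<n. c j *\<^sub>R f j))\<^sup>2) \<longlonglongrightarrow> (\<Sum>j. (c j)\<^sup>2)"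
    using summable_LIMSEQ[OF square_summable] by (simp add: norm_square_orthonormal_sum[OF orth])
  ultimately show "(norm (\<Sum>j. c j *\<^sub>R f j))\<^sup>2 = (\<Sum>j. (c j)\<^sup>2)"
    by (rule LIMSEQ_unique)
qed

lemma nonneg_definite_eigenvalue_nonneg:
  assumes "nonneg_definite Q" and "Q e = c *\<^sub>R e" and "norm e = 1"
  shows "0 \<le> c"
proof -
  have "Q e \<bullet> e = c"
    by (simp add: assms(2,3) dot_square_norm)
  then show ?thesis
    using assms(1) unfolding nonneg_definite_def by metis
qed

text \<open>Factor \<open>R\<^sup>2 - c\<^sup>2 = (R + c) (R - c)\<close>: the vector \<open>v = R e - c e\<close> satisfies \<open>R v = - c v\<close>, which for
  \<open>c > 0\<close> and nonnegative \<open>R\<close> forces \<open>v = 0\<close>. If \<open>c = 0\<close>, then \<open>\<bar>R e\<bar>\<^sup>2 = R (R e) \<bullet> e = 0\<close> by symmetry.\<close>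

lemma square_root_eigenvector:
  fixes R :: "'k::real_inner \<Rightarrow> 'k"
  assumes R: "bounded_linear R" "symmetric_op R" "nonneg_definite R"
    and eig: "R (R e) = c\<^sup>2 *\<^sub>R e" and "0 \<le> c"
  shows "R e = c *\<^sub>R e"
proof -
  interpret R: bounded_linear R by fact
  have sym: "R x \<bullet> y = x \<bullet> R y" and nn: "0 \<le> R x \<bullet> x" for x y
    using R by (auto simp: symmetric_op_def nonneg_definite_def)
  define v where "v = R e - c *\<^sub>R e"
  have Rv: "R v = - (c *\<^sub>R v)"
    by (simp add: v_def R.diff R.scaleR eig scaleR_diff_right power2_eq_square)
  show ?thesis
  proof (cases "c = 0")
    case True
    then have "R e \<bullet> R e = 0"
      using sym[of e "R e"] eig by simp
    then show ?thesis using True by simp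
  next
    case False
    have "R v \<bullet> v = - (c * (v \<bullet> v))"
      by (simp add: Rv)
    then have "c * (v \<bullet> v) \<le> 0"
      using nn[of v] by simp
    then have "v \<bullet> v \<le> 0"
      using False \<open>0 \<le> c\<close> by (simp add: mult_le_0_iff)
    then have "v = 0"
      by (metis inner_gt_zero_iff not_less)
    then show ?thesis by (simp add: v_def)
  qed
qed

text \<open>Being trace class is a condition on the absolute value \<open>R\<close> of \<open>Q\<close>. As \<open>Q\<close> is symmetric and nonnegative,
  \<open>R\<close> is a square root of \<open>Q\<^sup>2\<close> and has the eigenvalues of \<open>Q\<close>, so that its trace in the basis \<open>f\<close> is the
  sum of the \<open>l j\<close>.\<close>

lemma trace_class_eigenvalues_summable:
  fixes Q :: "'k::real_inner \<Rightarrow> 'k"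
  assumes Q: "nonneg_definite Q" "symmetric_op Q" "trace_class Q"
    and f: "inj f" "orthonormal_basis (range f)"
    and eig: "\<And>j::nat. Q (f j) = l j *\<^sub>R f j"
  shows "summable l"
proof -
  have nf: "norm (f j) = 1" for j
    using f(2) by (auto simp: orthonormal_basis_def)
  have lin: "bounded_linear Q"
    using Q(3) by (auto simp: trace_class_def)
  obtain R where R: "bounded_linear R" "symmetric_op R" "nonneg_definite R"
    and RR: "R \<circ> R = adjoint Q \<circ> Q"
    and summ: "\<And>B. orthonormal_basis B \<Longrightarrow> (\<lambda>e. R e \<bullet> e) summable_on B"
    using Q(3) unfolding trace_class_def by (metis (no_types))
  have "adjoint Q = Q"
    using Q(2) by (intro adjoint_unique) (simp add: symmetric_op_def)
  then have "R (R (f j)) = (l j)\<^sup>2 *\<^sub>R f j" for j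
    using fun_cong[OF RR, of "f j"] eig[of j] bounded_linear.linear[OF lin]
    by (simp add: linear_scale power2_eq_square)
  then have "R (f j) = l j *\<^sub>R f j" for j
    by (rule square_root_eigenvector[OF R])
      (rule nonneg_definite_eigenvalue_nonneg[OF Q(1) eig nf])
  then have "((\<lambda>e. R e \<bullet> e) \<circ> f) = l"
    by (auto simp: fun_eq_iff dot_square_norm nf)
  moreover have "((\<lambda>e. R e \<bullet> e) \<circ> f) summable_on UNIV"
    using summ[OF f(2)] summable_on_reindex[OF f(1)] by blast
  ultimately show "summable l"
    using summable_on_UNIV_nonneg_real_iff[of l] nonneg_definite_eigenvalue_nonneg[OF Q(1) eig nf]
    by simp
qed

section \<open>Processes with independent increments\<close>

lemma Int_stable_vimage_sets: "Int_stable {X -` A \<inter> \<Omega> | A. A \<in> sets N}"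
proof (rule Int_stableI)
  fix p q assume "p \<in> {X -` A \<inter> \<Omega> | A. A \<in> sets N}" "q \<in> {X -` A \<inter> \<Omega> | A. A \<in> sets N}"
  then obtain A B where "A \<in> sets N" "p = X -` A \<inter> \<Omega>" "B \<in> sets N" "q = X -` B \<inter> \<Omega>"
    by blast
  then have "A \<inter> B \<in> sets N" "p \<inter> q = X -` (A \<inter> B) \<inter> \<Omega>"
    by auto
  then show "p \<inter> q \<in> {X -` A \<inter> \<Omega> | A. A \<in> sets N}"
    by blast
qed

text \<open>The definition of independent increments speaks of finitely many increments along an increasing
  sequence of times. An event that restricts \<open>X\<close> at finitely many times up to \<open>u\<close> depends only on the
  increments along the sorted list of these times, and \<open>X b - X u\<close> is the next increment after them.
  These events form a \<open>\<pi>\<close>-system that generates the past. The values are measured from \<open>X 0\<close>, since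
  only differences are sums of increments.\<close>

lemma (in prob_space) increment_indep_past_increments:
  assumes meas: "\<And>t. 0 \<le> t \<Longrightarrow> X t \<in> borel_measurable M"
    and inc: "independent_increments M X"
    and u: "0 \<le> u" "u \<le> b"
  shows "indep_set
    (sigma_sets (space M) {(\<lambda>\<omega>. X b \<omega> - X u \<omega>) -` B \<inter> space M | B. B \<in> sets borel})
    (sigma_sets (space M)
      {(\<lambda>\<omega>. X s \<omega> - X 0 \<omega>) -` B \<inter> space M | s B. 0 \<le> s \<and> s \<le> u \<and> B \<in> sets borel})"
proof -
  let ?D = "\<lambda>\<omega>. X b \<omega> - X u \<omega>"
  define cyl where "cyl S B = {\<omega>\<in>space M. \<forall>s\<in>S. X s \<omega> - X 0 \<omega> \<in> B s}"
    for S :: "real set" and B :: "real \<Rightarrow> real set"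
  define Pi where "Pi = {cyl S B | S B. finite S \<and> S \<subseteq> {0..u} \<and> (\<forall>s. B s \<in> sets borel)}"
  define Inc where "Inc = {?D -` B \<inter> space M | B. B \<in> sets borel}"
  have [measurable]: "?D \<in> borel_measurable M"
    using meas u by auto
  have cyl_meas: "cyl S B \<in> events"
    if "finite S" "S \<subseteq> {0..u}" "\<And>s. B s \<in> sets borel" for S B
  proof -
    have "X 0 \<in> borel_measurable M" "\<And>s. s \<in> S \<Longrightarrow> X s \<in> borel_measurable M"
      using meas that by auto
    then show ?thesis
      unfolding cyl_def using that by measurable
  qed
  have "indep_set Inc Pi"
  proof (rule indep_setI)
    show "Inc \<subseteq> events"
      by (auto simp: Inc_def)
    show "Pi \<subseteq> events"
      using cyl_meas by (auto simp: Pi_def)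
    fix d p assume "d \<in> Inc" "p \<in> Pi"
    then obtain C S B where C: "C \<in> sets borel" "d = ?D -` C \<inter> space M"
      and S: "finite S" "S \<subseteq> {0..u}" "\<And>s. B s \<in> sets borel" "p = cyl S B"
      unfolding Inc_def Pi_def by blast
    define L where "L = sorted_list_of_set (S \<union> {0, u})"
    define n where "n = length L - 1"
    \<comment> \<open>After its last entry \<open>u\<close> the list is continued by \<open>b\<close>, so the increment of number \<open>n\<close> is \<open>X b - X u\<close>.\<close>
    define t where "t i = (if i < length L then L ! i else b)" for i
    have setL: "set L = S \<union> {0, u}" and sortedL: "sorted L"
      using S(1) unfolding L_def by (simp_all only: set_sorted_list_of_set sorted_sorted_list_of_set finite_Un finite.intros)
    then have lenL: "length L = Suc n"
      unfolding n_def by (cases L) auto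
    have memL: "L ! i \<in> {0..u}" if "i < length L" for i
      using nth_mem[OF that] setL S(2) u by auto
    obtain i0 iu where i0: "i0 < length L" "L ! i0 = 0" and iu: "iu < length L" "L ! iu = u"
      using setL by (metis Un_iff in_set_conv_nth insertI1 insertI2)
    have t0: "t 0 = 0"
      using sorted_nth_mono[OF sortedL, of 0 i0] i0 memL[of 0] lenL by (auto simp: t_def)
    have tn: "t n = u"
      using sorted_nth_mono[OF sortedL, of iu n] iu memL[of n] lenL by (auto simp: t_def)
    have tSn: "t (Suc n) = b"
      by (simp add: t_def lenL)
    have mono_t: "mono t"
    proof (rule monoI)
      fix i j :: nat assume "i \<le> j"
      then show "t i \<le> t j"
        using sorted_nth_mono[OF sortedL, of i j] memL[of i] u by (auto simp: t_def)
    qed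
    let ?inc = "\<lambda>i \<omega>. X (t (Suc i)) \<omega> - X (t i) \<omega>"
    have "indep_vars (\<lambda>_. borel) ?inc {..<Suc n}"
      using inc mono_t t0 unfolding independent_increments_def by simp
    then have iv: "indep_var (PiM {n} (\<lambda>_. borel)) (\<lambda>\<omega>. restrict (\<lambda>i. ?inc i \<omega>) {n})
        (PiM {..<n} (\<lambda>_. borel)) (\<lambda>\<omega>. restrict (\<lambda>i. ?inc i \<omega>) {..<n})"
      by (rule indep_var_restrict) auto
    have "\<exists>k. k \<le> n \<and> t k = s" if "s \<in> S" for s
    proof -
      have "s \<in> set L"
        using that setL by simp
      then obtain k where "k < length L" "L ! k = s"
        by (auto simp: in_set_conv_nth)
      then show ?thesis
        using lenL by (intro exI[of _ k]) (simp add: t_def)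
    qed
    then obtain k where k: "\<And>s. s \<in> S \<Longrightarrow> k s \<le> n" "\<And>s. s \<in> S \<Longrightarrow> t (k s) = s"
      by metis
    define C' where "C' = {g \<in> space (PiM {n} (\<lambda>_. borel :: real measure)). g n \<in> C}"
    define B' where "B' = {g \<in> space (PiM {..<n} (\<lambda>_. borel :: real measure)). \<forall>s\<in>S. (\<Sum>i<k s. g i) \<in> B s}"
    have C': "C' \<in> sets (PiM {n} (\<lambda>_. borel))"
      unfolding C'_def using C(1) by measurable
    have B': "B' \<in> sets (PiM {..<n} (\<lambda>_. borel))"
    proof -
      have "(\<lambda>g. \<Sum>i<k s. g i) \<in> borel_measurable (PiM {..<n} (\<lambda>_. borel :: real measure))" if "s \<in> S" for s
        using k(1)[OF that] by (intro borel_measurable_sum measurable_component_singleton) auto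
      then show ?thesis
        unfolding B'_def using S(1,3) by measurable
    qed
    have d: "d = (\<lambda>\<omega>. restrict (\<lambda>i. ?inc i \<omega>) {n}) -` C' \<inter> space M"
      by (auto simp: C(2) C'_def space_PiM tn tSn)
    have tel: "(\<Sum>i<k s. restrict (\<lambda>i. ?inc i \<omega>) {..<n} i) = X s \<omega> - X 0 \<omega>" if "s \<in> S" for s \<omega>
    proof -
      have "(\<Sum>i<k s. restrict (\<lambda>i. ?inc i \<omega>) {..<n} i) = (\<Sum>i<k s. ?inc i \<omega>)"
        using k(1)[OF that] by (intro sum.cong) auto
      also have "\<dots> = X s \<omega> - X 0 \<omega>"
        using sum_lessThan_telescope[of "\<lambda>i. X (t i) \<omega>" "k s"] k(2)[OF that] t0 by simp
      finally show ?thesis .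
    qed
    have p: "p = (\<lambda>\<omega>. restrict (\<lambda>i. ?inc i \<omega>) {..<n}) -` B' \<inter> space M"
      by (auto simp: S(4) cyl_def B'_def space_PiM tel simp del: restrict_apply)
    show "prob (d \<inter> p) = prob d * prob p"
      unfolding d p using indep_varD[OF iv C' B']
      by (simp add: vimage_def Int_def conj_ac)
  qed
  moreover have "Int_stable Inc"
    unfolding Inc_def by (rule Int_stable_vimage_sets)
  moreover have "Int_stable Pi"
  proof (rule Int_stableI)
    fix p q assume "p \<in> Pi" "q \<in> Pi"
    then obtain S B S' B' where "p = cyl S B" "q = cyl S' B'"
      and S: "finite S" "S \<subseteq> {0..u}" "\<And>s. B s \<in> sets borel"
      and S': "finite S'" "S' \<subseteq> {0..u}" "\<And>s. B' s \<in> sets borel"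
      unfolding Pi_def by blast
    then have "p \<inter> q = cyl (S \<union> S') (\<lambda>s. (if s \<in> S then B s else UNIV) \<inter> (if s \<in> S' then B' s else UNIV))"
      by (auto simp: cyl_def)
    moreover have "\<forall>s. (if s \<in> S then B s else UNIV) \<inter> (if s \<in> S' then B' s else UNIV) \<in> sets borel"
      using S S' by auto
    ultimately show "p \<inter> q \<in> Pi"
      using S S' unfolding Pi_def by blast
  qed
  ultimately have "indep_set (sigma_sets (space M) Inc) (sigma_sets (space M) Pi)"
    by (rule indep_set_sigma_sets)
  moreover have "{(\<lambda>\<omega>. X s \<omega> - X 0 \<omega>) -` B \<inter> space M | s B. 0 \<le> s \<and> s \<le> u \<and> B \<in> sets borel} \<subseteq> Pi"
  proof clarify
    fix s B assume "0 \<le> s" "s \<le> u" "B \<in> sets (borel :: real measure)"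
    moreover have "(\<lambda>\<omega>. X s \<omega> - X 0 \<omega>) -` B \<inter> space M = cyl {s} (\<lambda>_. B)"
      by (auto simp: cyl_def)
    ultimately show "(\<lambda>\<omega>. X s \<omega> - X 0 \<omega>) -` B \<inter> space M \<in> Pi"
      unfolding Pi_def by (auto intro!: exI[of _ "{s}"] exI[of _ "\<lambda>_. B"])
  qed
  ultimately show ?thesis
    unfolding indep_sets2_eq Inc_def[symmetric] by (meson sigma_sets_mono' subset_iff subsetI)
qed

section \<open>Brownian motions and an independent clock\<close>

text \<open>The martingale property holds for every clock \<open>E\<close> that is nonnegative, increasing, integrable and
  independent of the Brownian motions. Nonnegativity and monotonicity hold outside a null set that may
  depend on the times; this is what an inverse subordinator satisfies, and as the \<open>\<sigma>\<close>-fields in question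
  contain all null sets, such exceptions do not affect measurability.\<close>

locale independent_clock = prob_space M + complete_measure M for M :: "'a measure" +
  fixes w :: "nat \<Rightarrow> real \<Rightarrow> 'a \<Rightarrow> real" and E :: "real \<Rightarrow> 'a \<Rightarrow> real"
  assumes brownian: "standard_brownian_motion M (w j)"
    and indep_w: "independent_processes M w"
    and indep_E: "family_independent_of M w E"
    and E_measurable [measurable]: "0 \<le> t \<Longrightarrow> E t \<in> borel_measurable M"
    and E_nonneg: "0 \<le> t \<Longrightarrow> AE \<omega> in M. 0 \<le> E t \<omega>"
    and E_mono: "0 \<le> s \<Longrightarrow> s \<le> t \<Longrightarrow> AE \<omega> in M. E s \<omega> \<le> E t \<omega>"
    and E_integrable: "0 \<le> t \<Longrightarrow> integrable M (E t)"
begin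

lemma w_measurable [measurable]: "0 \<le> t \<Longrightarrow> w j t \<in> borel_measurable M"
  and w_start: "AE \<omega> in M. w j 0 \<omega> = 0"
  and w_independent_increments: "independent_increments M (w j)"
  and w_normal: "0 \<le> s \<Longrightarrow> s < t \<Longrightarrow>
      distributed M lborel (\<lambda>\<omega>. w j t \<omega> - w j s \<omega>) (normal_density 0 (sqrt (t - s)))"
  and w_continuous: "AE \<omega> in M. continuous_on {0..} (\<lambda>t. w j t \<omega>)"
  using brownian[of j] by (simp_all add: standard_brownian_motion_def)

abbreviation BM :: "real \<Rightarrow> 'a measure" where
  "BM \<equiv> bm_sigma M w E"

lemma BM_generators:
  "{w j s -` B \<inter> space M | j s B. 0 \<le> s \<and> s \<le> u \<and> B \<in> sets borel} \<union>
   {E s -` B \<inter> space M | s B. 0 \<le> s \<and> B \<in> sets borel} \<union> null_sets M \<subseteq> sets M"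
  by (auto intro!: measurable_sets[OF w_measurable] measurable_sets[OF E_measurable])

lemma sets_BM: "sets (BM u) = sigma_sets (space M)
     ({w j s -` B \<inter> space M | j s B. 0 \<le> s \<and> s \<le> u \<and> B \<in> sets borel} \<union>
      {E s -` B \<inter> space M | s B. 0 \<le> s \<and> B \<in> sets borel} \<union> null_sets M)"
  unfolding bm_sigma_def
  by (rule sets_measure_of) (rule order_trans[OF BM_generators sets.space_closed])

lemma space_BM [simp]: "space (BM u) = space M"
  by (simp add: bm_sigma_def space_measure_of_conv)

lemma sets_BM_subset: "sets (BM u) \<subseteq> sets M"
  unfolding sets_BM by (rule sets.sigma_sets_subset[OF BM_generators])

lemma sets_BM_mono: "u \<le> v \<Longrightarrow> sets (BM u) \<subseteq> sets (BM v)"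
  unfolding sets_BM by (intro sigma_sets_mono' Un_mono order_refl) (blast intro: order_trans)

lemma null_sets_BM: "A \<in> null_sets M \<Longrightarrow> A \<in> sets (BM u)"
  unfolding sets_BM by auto

lemma E_measurable_BM [measurable]: "0 \<le> t \<Longrightarrow> E t \<in> borel_measurable (BM u)"
  by (rule measurableI) (auto simp: sets_BM intro!: sigma_sets.Basic)

lemma w_measurable_BM: "0 \<le> s \<Longrightarrow> s \<le> u \<Longrightarrow> w j s \<in> borel_measurable (BM u)"
  by (rule measurableI) (auto simp: sets_BM intro!: sigma_sets.Basic)

text \<open>By completeness of \<open>M\<close> the symmetric difference of the two sets is a null set, and so are all its
  subsets; all of them belong to \<open>BM u\<close>.\<close>

lemma sets_BM_AE_cong:
  assumes A: "A \<in> sets (BM u)" and ae: "AE \<omega> in M. \<omega> \<in> A \<longleftrightarrow> \<omega> \<in> B" and B: "B \<subseteq> space M"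
  shows "B \<in> sets (BM u)"
proof -
  define N where "N = {\<omega>\<in>space M. \<not> (\<omega> \<in> A \<longleftrightarrow> \<omega> \<in> B)}"
  have N: "N \<in> null_sets M"
    using ae unfolding AE_iff_null_sets N_def .
  have "A \<subseteq> space M"
    using sets.sets_into_space[OF A] by simp
  then have "B = (A - N) \<union> (B \<inter> N)"
    using B by (auto simp: N_def)
  moreover have "B \<inter> N \<in> sets (BM u)"
    by (rule null_sets_BM, rule complete2[OF _ N]) auto
  ultimately show ?thesis
    using A null_sets_BM[OF N] by (metis sets.Un sets.Diff)
qed

lemma measurable_BM_AE_cong:
  fixes f g :: "'a \<Rightarrow> real"
  assumes f: "f \<in> borel_measurable (BM u)" and ae: "AE \<omega> in M. f \<omega> = g \<omega>"
  shows "g \<in> borel_measurable (BM u)"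
proof (rule measurableI)
  fix B assume B: "B \<in> sets (borel :: real measure)"
  have "f -` B \<inter> space M \<in> sets (BM u)"
    using measurable_sets[OF f B] by simp
  then have "g -` B \<inter> space M \<in> sets (BM u)"
    by (rule sets_BM_AE_cong) (use ae in auto)
  then show "g -` B \<inter> space (BM u) \<in> sets (BM u)"
    by simp
qed auto

text \<open>Adding the clock and the other Brownian motions to the past of \<open>w j\<close> leaves its future increments
  independent of the past. Up to null sets, the \<open>\<sigma>\<close>-field \<open>BM u\<close> is generated by the \<open>\<pi>\<close>-system of
  intersections \<open>p \<inter> a \<inter> c\<close>, where \<open>p\<close> comes from the increments of \<open>w j\<close> up to \<open>u\<close>, \<open>a\<close> from the other
  Brownian motions and \<open>c\<close> from the clock. For such an event, the probability of its intersection with an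
  event of the increment factors in three steps: the clock splits off, then the other Brownian motions,
  and then the past of \<open>w j\<close>.\<close>

lemma increment_indep_BM:
  assumes u: "0 \<le> u" "u \<le> b" and A: "A \<in> sets (BM u)" and B: "B \<in> sets borel"
  shows "prob ((\<lambda>\<omega>. w j b \<omega> - w j u \<omega>) -` B \<inter> space M \<inter> A) =
         prob ((\<lambda>\<omega>. w j b \<omega> - w j u \<omega>) -` B \<inter> space M) * prob A"
proof -
  let ?D = "\<lambda>\<omega>. w j b \<omega> - w j u \<omega>"
  define W where "W I = {w i s -` B \<inter> space M | i s B. i \<in> I \<and> 0 \<le> s \<and> B \<in> sets borel}" for I
  define P where "P = {(\<lambda>\<omega>. w j s \<omega> - w j 0 \<omega>) -` B \<inter> space M | s B. 0 \<le> s \<and> s \<le> u \<and> B \<in> sets borel}"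
  define C where "C = {E s -` B \<inter> space M | s B. 0 \<le> s \<and> B \<in> sets borel}"
  let ?\<sigma> = "\<lambda>G. sigma_sets (space M) G"
  define Dg where "Dg = {?D -` B \<inter> space M | B. B \<in> sets borel}"
  have sub: "W I \<subseteq> events" "P \<subseteq> events" "C \<subseteq> events" "Dg \<subseteq> events" for I
    unfolding W_def P_def C_def Dg_def using u
    by (auto intro!: measurable_sets[where A=borel] borel_measurable_diff)
  note ev = sets.sigma_sets_subset[OF sub(1)] sets.sigma_sets_subset[OF sub(2)]
    sets.sigma_sets_subset[OF sub(3)] sets.sigma_sets_subset[OF sub(4)]
  have pow: "G \<subseteq> events \<Longrightarrow> G \<subseteq> Pow (space M)" for G
    using sets.space_closed by blast

  have indep_DP: "prob (d \<inter> p) = prob d * prob p" if "d \<in> ?\<sigma> Dg" "p \<in> ?\<sigma> P" for d p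
    using increment_indep_past_increments[of "w j" u b, OF w_measurable w_independent_increments u] that
    unfolding Dg_def P_def by (rule indep_setD)

  have indep_j: "prob (a \<inter> c) = prob a * prob c" if "a \<in> ?\<sigma> (W {j})" "c \<in> ?\<sigma> (W (- {j}))" for a c
  proof -
    let ?X = "\<lambda>j \<omega>. \<lambda>t\<in>{0..}. w j t \<omega>"
    let ?G = "\<lambda>i. {?X i -` A \<inter> space M | A. A \<in> sets (PiM {0..} (\<lambda>_. borel))}"
    have "indep_sets ?G UNIV"
      using indep_w unfolding independent_processes_def indep_vars_def2 by blast
    then have "indep_sets ?G (\<Union>b\<in>UNIV. case_bool {j} (- {j}) b)"
      by (rule indep_sets_mono_index[rotated]) auto
    then have "indep_sets (\<lambda>b. ?\<sigma> (\<Union>i\<in>case_bool {j} (- {j}) b. ?G i)) UNIV"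
    proof (rule indep_sets_collect_sigma)
      show "Int_stable (?G i)" for i
        by (rule Int_stable_vimage_sets)
      show "disjoint_family_on (case_bool {j} (- {j})) UNIV"
        by (auto simp: disjoint_family_on_def split: bool.split)
    qed
    then have "indep_set (?\<sigma> (\<Union>i\<in>{j}. ?G i)) (?\<sigma> (\<Union>i\<in>-{j}. ?G i))"
      unfolding indep_set_def by (rule indep_sets_mono_sets) (auto split: bool.split)
    moreover have "?\<sigma> (W I) \<subseteq> ?\<sigma> (\<Union>i\<in>I. ?G i)" for I
    proof (rule sigma_sets_mono', unfold W_def, clarify)
      fix i s B assume i: "i \<in> I" and s: "0 \<le> (s::real)" and B: "B \<in> sets (borel :: real measure)"
      have "(\<lambda>f. f s) -` B \<inter> space (PiM {0..} (\<lambda>_. borel)) \<in> sets (PiM {0::real..} (\<lambda>_. borel))"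
        using s B by (intro measurable_sets[OF measurable_component_singleton]) auto
      moreover have "w i s -` B \<inter> space M =
          ?X i -` ((\<lambda>f. f s) -` B \<inter> space (PiM {0..} (\<lambda>_. borel))) \<inter> space M"
        using s by (auto simp: space_PiM)
      ultimately show "w i s -` B \<inter> space M \<in> (\<Union>i\<in>I. ?G i)"
        using i by blast
    qed
    ultimately show ?thesis
      using that indep_setD by blast
  qed

  have indep_C: "prob (a \<inter> c) = prob a * prob c" if a: "a \<in> ?\<sigma> (W UNIV)" and c: "c \<in> ?\<sigma> C" for a c
  proof -
    let ?X = "\<lambda>\<omega>. \<lambda>(j, t)\<in>UNIV \<times> {0..}. w j t \<omega>" and ?Y = "\<lambda>\<omega>. \<lambda>t\<in>{0..}. E t \<omega>"
    let ?VX = "vimage_algebra (space M) ?X (PiM (UNIV \<times> {0..}) (\<lambda>_. borel))"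
    let ?VY = "vimage_algebra (space M) ?Y (PiM {0..} (\<lambda>_. borel))"
    have "W UNIV \<subseteq> sets ?VX"
    proof (unfold W_def, clarify)
      fix i :: nat and s B assume s: "0 \<le> (s::real)" and B: "B \<in> sets (borel :: real measure)"
      have "(\<lambda>f. f (i, s)) -` B \<inter> space (PiM (UNIV \<times> {0..}) (\<lambda>_. borel)) \<in> sets (PiM (UNIV \<times> {0::real..}) (\<lambda>_. borel))"
        using s B by (intro measurable_sets[OF measurable_component_singleton]) auto
      moreover have "w i s -` B \<inter> space M =
          ?X -` ((\<lambda>f. f (i, s)) -` B \<inter> space (PiM (UNIV \<times> {0..}) (\<lambda>_. borel))) \<inter> space M"
        using s by (auto simp: space_PiM PiE_def extensional_def)
      ultimately show "w i s -` B \<inter> space M \<in> sets ?VX"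
        by (simp only: in_vimage_algebra)
    qed
    moreover have "C \<subseteq> sets ?VY"
    proof (unfold C_def, clarify)
      fix s B assume s: "0 \<le> (s::real)" and B: "B \<in> sets (borel :: real measure)"
      have "(\<lambda>f. f s) -` B \<inter> space (PiM {0..} (\<lambda>_. borel)) \<in> sets (PiM {0::real..} (\<lambda>_. borel))"
        using s B by (intro measurable_sets[OF measurable_component_singleton]) auto
      moreover have "E s -` B \<inter> space M =
          ?Y -` ((\<lambda>f. f s) -` B \<inter> space (PiM {0..} (\<lambda>_. borel))) \<inter> space M"
        using s by (auto simp: space_PiM)
      ultimately show "E s -` B \<inter> space M \<in> sets ?VY"
        by (simp only: in_vimage_algebra)
    qed
    ultimately have "a \<in> sets ?VX" "c \<in> sets ?VY"
      using subsetD[OF sets.sigma_sets_subset[of "W UNIV" ?VX], of a]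
        subsetD[OF sets.sigma_sets_subset[of C ?VY], of c] a c
      by (simp_all only: space_vimage_algebra)
    then show ?thesis
      by (rule indep_setD[OF indep_E[unfolded family_independent_of_def]])
  qed

  have W_meas: "w i s \<in> borel_measurable (sigma (space M) (W I))" if "i \<in> I" "0 \<le> s" for i s I
    using that pow[OF sub(1)]
    by (intro measurableI) (auto simp: W_def intro!: sigma_sets.Basic)
  have P_W: "?\<sigma> P \<subseteq> ?\<sigma> (W {j})"
  proof (rule sigma_sets_mono, unfold P_def, clarify)
    fix s B assume "0 \<le> (s::real)" and B: "B \<in> sets (borel :: real measure)"
    then have "(\<lambda>\<omega>. w j s \<omega> - w j 0 \<omega>) \<in> borel_measurable (sigma (space M) (W {j}))"
      by (intro borel_measurable_diff W_meas) auto
    from measurable_sets[OF this B] show "(\<lambda>\<omega>. w j s \<omega> - w j 0 \<omega>) -` B \<inter> space M \<in> ?\<sigma> (W {j})"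
      using pow[OF sub(1)] by simp
  qed
  have D_W: "?\<sigma> Dg \<subseteq> ?\<sigma> (W {j})"
  proof (rule sigma_sets_mono, unfold Dg_def, clarify)
    fix B assume B: "B \<in> sets (borel :: real measure)"
    have "?D \<in> borel_measurable (sigma (space M) (W {j}))"
      using u by (intro borel_measurable_diff W_meas) auto
    from measurable_sets[OF this B] show "?D -` B \<inter> space M \<in> ?\<sigma> (W {j})"
      using pow[OF sub(1)] by simp
  qed
  have W_W: "?\<sigma> (W I) \<subseteq> ?\<sigma> (W UNIV)" for I
    by (rule sigma_sets_mono') (auto simp: W_def)
  have Int: "a \<inter> a' \<in> ?\<sigma> G" if "a \<in> ?\<sigma> G" "a' \<in> ?\<sigma> G" "G \<subseteq> events" for a a' G
    using that sets.Int[of a "sigma (space M) G" a'] pow[of G] by simp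
  have space_in: "space M \<in> ?\<sigma> G" for G
    by (rule sigma_sets_top)

  define Pi where "Pi = {p \<inter> a \<inter> c | p a c. p \<in> ?\<sigma> P \<and> a \<in> ?\<sigma> (W (- {j})) \<and> c \<in> ?\<sigma> C}"
  have prod3: "prob (x \<inter> a \<inter> c) = prob x * prob a * prob c"
    if "x \<in> ?\<sigma> (W {j})" "a \<in> ?\<sigma> (W (- {j}))" "c \<in> ?\<sigma> C" for x a c
    using indep_C[of "x \<inter> a" c] indep_j[OF that(1,2)] that W_W Int[of x "W UNIV" a] sub(1)
    by (auto simp: subset_iff)
  have indep_all: "indep_set (?\<sigma> (?\<sigma> Dg)) (?\<sigma> Pi)"
  proof (rule indep_set_sigma_sets)
    show "indep_set (?\<sigma> Dg) Pi"
    proof (rule indep_setI)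
      show "?\<sigma> Dg \<subseteq> events"
        by (rule ev)
      show "Pi \<subseteq> events"
        using ev unfolding Pi_def by blast
      fix d q assume d: "d \<in> ?\<sigma> Dg" and "q \<in> Pi"
      then obtain p a c where q: "q = p \<inter> a \<inter> c"
        and p: "p \<in> ?\<sigma> P" and a: "a \<in> ?\<sigma> (W (- {j}))" and c: "c \<in> ?\<sigma> C"
        unfolding Pi_def by blast
      have dW: "d \<in> ?\<sigma> (W {j})" and pW: "p \<in> ?\<sigma> (W {j})"
        using d p D_W P_W by auto
      have "prob (d \<inter> q) = prob (d \<inter> p \<inter> a \<inter> c)"
        by (simp add: q Int_assoc)
      also have "\<dots> = prob (d \<inter> p) * prob a * prob c"
        by (rule prod3[OF Int[OF dW pW sub(1)] a c])
      also have "\<dots> = prob d * (prob p * prob a * prob c)"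
        by (simp add: indep_DP[OF d p])
      also have "prob p * prob a * prob c = prob q"
        unfolding q by (rule prod3[OF pW a c, symmetric])
      finally show "prob (d \<inter> q) = prob d * prob q" .
    qed
    show "Int_stable (?\<sigma> Dg)"
      using Int[OF _ _ sub(4)] by (intro Int_stableI)
    show "Int_stable Pi"
    proof (rule Int_stableI)
      fix q q' assume "q \<in> Pi" "q' \<in> Pi"
      then obtain p a c p' a' c' where "q = p \<inter> a \<inter> c" "q' = p' \<inter> a' \<inter> c'"
        and mem: "p \<in> ?\<sigma> P" "a \<in> ?\<sigma> (W (- {j}))" "c \<in> ?\<sigma> C"
          "p' \<in> ?\<sigma> P" "a' \<in> ?\<sigma> (W (- {j}))" "c' \<in> ?\<sigma> C"
        unfolding Pi_def by blast
      then have "q \<inter> q' = (p \<inter> p') \<inter> (a \<inter> a') \<inter> (c \<inter> c')"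
        by auto
      moreover have "p \<inter> p' \<in> ?\<sigma> P" "a \<inter> a' \<in> ?\<sigma> (W (- {j}))" "c \<inter> c' \<in> ?\<sigma> C"
        using Int[OF _ _ sub(2)] Int[OF _ _ sub(1)] Int[OF _ _ sub(3)] mem by auto
      ultimately show "q \<inter> q' \<in> Pi"
        unfolding Pi_def by blast
    qed
  qed
  have indep_Pi: "prob (d \<inter> q) = prob d * prob q" if "d \<in> Dg" "q \<in> ?\<sigma> Pi" for d q
    by (rule indep_setD[OF indep_all _ that(2)]) (intro sigma_sets.Basic that(1))

  have Pi_I: "p \<inter> a \<inter> c \<in> ?\<sigma> Pi" if "p \<in> ?\<sigma> P" "a \<in> ?\<sigma> (W (- {j}))" "c \<in> ?\<sigma> C" for p a c
    using that unfolding Pi_def by (intro sigma_sets.Basic) blast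
  have in_space: "x \<inter> space M = x" "space M \<inter> x = x" if "x \<in> events" for x
    using sets.sets_into_space[OF that] by auto
  have Pi_sub: "P \<subseteq> ?\<sigma> Pi" "W (- {j}) \<subseteq> ?\<sigma> Pi" "C \<subseteq> ?\<sigma> Pi"
  proof safe
    fix x assume x: "x \<in> P"
    show "x \<in> ?\<sigma> Pi"
      using Pi_I[OF sigma_sets.Basic[OF x] space_in space_in] in_space subsetD[OF sub(2) x] by simp
  next
    fix x assume x: "x \<in> W (- {j})"
    show "x \<in> ?\<sigma> Pi"
      using Pi_I[OF space_in sigma_sets.Basic[OF x] space_in] in_space subsetD[OF sub(1) x] by simp
  next
    fix x assume x: "x \<in> C"
    show "x \<in> ?\<sigma> Pi"
      using Pi_I[OF space_in space_in sigma_sets.Basic[OF x]] in_space subsetD[OF sub(3) x] by simp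
  qed

  \<comment> \<open>The generators of \<open>BM u\<close> agree with events of the \<open>\<pi>\<close>-system only up to null sets: \<open>w j s\<close> is replaced
    by \<open>w j s - w j 0\<close>, and null sets are replaced by the empty set.\<close>
  have "\<exists>A'\<in>?\<sigma> Pi. AE \<omega> in M. \<omega> \<in> A \<longleftrightarrow> \<omega> \<in> A'"
    using A unfolding sets_BM
  proof induction
    case (Basic a)
    then consider (w) i s B where "a = w i s -` B \<inter> space M" "0 \<le> s" "s \<le> u" "B \<in> sets borel"
      | (E) "a \<in> C" | (null) "a \<in> null_sets M"
      unfolding C_def by blast
    then show ?case
    proof cases
      case w
      show ?thesis
      proof (cases "i = j")
        case True
        have "(\<lambda>\<omega>. w j s \<omega> - w j 0 \<omega>) -` B \<inter> space M \<in> ?\<sigma> Pi"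
          using w Pi_sub(1) unfolding P_def by blast
        moreover have "AE \<omega> in M. \<omega> \<in> a \<longleftrightarrow> \<omega> \<in> (\<lambda>\<omega>. w j s \<omega> - w j 0 \<omega>) -` B \<inter> space M"
          using w_start[of j] by eventually_elim (simp add: w True)
        ultimately show ?thesis
          by blast
      next
        case False
        then have "a \<in> W (- {j})"
          using w unfolding W_def by blast
        then show ?thesis
          using Pi_sub by auto
      qed
    next
      case E
      then show ?thesis
        using Pi_sub by auto
    next
      case null
      then have "AE \<omega> in M. \<omega> \<in> a \<longleftrightarrow> \<omega> \<in> {}"
        by (auto dest: AE_not_in)
      then show ?thesis
        using sigma_sets.Empty by blast
    qed
  next
    case Empty
    then show ?case
      using sigma_sets.Empty by auto
  next
    case (Compl a)
    then obtain a' where "a' \<in> ?\<sigma> Pi" and ae: "AE \<omega> in M. \<omega> \<in> a \<longleftrightarrow> \<omega> \<in> a'"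
      by blast
    then have "space M - a' \<in> ?\<sigma> Pi"
      by (intro sigma_sets.Compl)
    moreover have "AE \<omega> in M. \<omega> \<in> space M - a \<longleftrightarrow> \<omega> \<in> space M - a'"
      using ae by eventually_elim simp
    ultimately show ?case
      by blast
  next
    case (Union a)
    then obtain a' where a': "\<And>i. a' i \<in> ?\<sigma> Pi" and ae: "\<And>i. AE \<omega> in M. \<omega> \<in> a i \<longleftrightarrow> \<omega> \<in> a' i"
      by metis
    have "(\<Union>i. a' i) \<in> ?\<sigma> Pi"
      using a' by (rule sigma_sets.Union)
    moreover have "AE \<omega> in M. \<forall>i. \<omega> \<in> a i \<longleftrightarrow> \<omega> \<in> a' i"
      using ae by (simp add: AE_all_countable)
    then have "AE \<omega> in M. \<omega> \<in> (\<Union>i. a i) \<longleftrightarrow> \<omega> \<in> (\<Union>i. a' i)"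
      by eventually_elim simp
    ultimately show ?case
      by blast
  qed
  then obtain A' where A': "A' \<in> ?\<sigma> Pi" and ae: "AE \<omega> in M. \<omega> \<in> A \<longleftrightarrow> \<omega> \<in> A'"
    by blast
  have A'_ev: "A' \<in> events"
  proof -
    have "Pi \<subseteq> events"
      using ev unfolding Pi_def by blast
    then show ?thesis
      using A' sets.sigma_sets_subset by blast
  qed
  have A_ev: "A \<in> events"
    using A sets_BM_subset by auto
  let ?d = "?D -` B \<inter> space M"
  have d: "?d \<in> Dg" "?d \<in> events"
    using B sub(4) unfolding Dg_def by blast+
  have "prob (?d \<inter> A) = prob (?d \<inter> A')"
    using d(2) A_ev A'_ev by (intro measure_eq_AE) (use ae in auto)
  moreover have "prob A = prob A'"
    using A_ev A'_ev ae by (intro measure_eq_AE) auto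
  ultimately show ?thesis
    using indep_Pi[OF d(1) A'] by simp
qed

end

context independent_clock begin

lemma increment_moments:
  assumes "0 \<le> a" "a \<le> b"
  shows "integrable M (\<lambda>\<omega>. w j b \<omega> - w j a \<omega>)" (is "integrable M ?D")
    and "expectation (\<lambda>\<omega>. w j b \<omega> - w j a \<omega>) = 0"
    and "integrable M (\<lambda>\<omega>. (w j b \<omega> - w j a \<omega>)\<^sup>2)"
    and "expectation (\<lambda>\<omega>. (w j b \<omega> - w j a \<omega>)\<^sup>2) = b - a"
proof -
  have "integrable M ?D \<and> expectation ?D = 0 \<and>
      integrable M (\<lambda>\<omega>. (?D \<omega>)\<^sup>2) \<and> expectation (\<lambda>\<omega>. (?D \<omega>)\<^sup>2) = b - a"
  proof (cases "a = b")
    case True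
    then show ?thesis by simp
  next
    case False
    with assms have pos: "0 < sqrt (b - a)"
      by simp
    note D = w_normal[of a b j]
    have ab: "0 \<le> a" "a < b"
      using assms False by auto
    have E0: "expectation ?D = 0"
      using normal_distributed_expectation[OF pos D[OF ab]] .
    have "integrable lborel (\<lambda>x. normal_density 0 (sqrt (b - a)) x * x ^ k)" for k
      using integrable_normal_moment[OF pos, of 0 k] by simp
    then have int: "integrable M (\<lambda>\<omega>. ?D \<omega> ^ k)" for k
      using distributed_integrable[OF D[OF ab], of "\<lambda>x. x ^ k"] by simp
    have "variance ?D = b - a"
      using normal_distributed_variance[OF pos D[OF ab]] ab by simp
    then show ?thesis
      using E0 int[of 1] int[of 2] by simp
  qed
  then show "integrable M ?D" "expectation ?D = 0"
      "integrable M (\<lambda>\<omega>. (?D \<omega>)\<^sup>2)" "expectation (\<lambda>\<omega>. (?D \<omega>)\<^sup>2) = b - a"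
    by blast+
qed

lemma increment_indep_indicator:
  assumes "0 \<le> a" "a \<le> b" and A: "A \<in> sets (BM a)"
  shows "indep_var borel (\<lambda>\<omega>. w j b \<omega> - w j a \<omega>) borel (indicator A :: 'a \<Rightarrow> real)"
proof -
  let ?D = "\<lambda>\<omega>. w j b \<omega> - w j a \<omega>"
  let ?SD = "{?D -` B \<inter> space M | B. B \<in> sets borel}"
  let ?SA = "{(indicator A :: 'a \<Rightarrow> real) -` B \<inter> space M | B. B \<in> sets borel}"
  have A_ev: "A \<in> events"
    using A sets_BM_subset by auto
  have D: "?D \<in> borel_measurable M"
    using assms by (intro borel_measurable_diff w_measurable) auto
  have SA: "?SA \<subseteq> sets (BM a)"
  proof clarify
    fix B assume "B \<in> sets (borel :: real measure)"
    then show "(indicator A :: 'a \<Rightarrow> real) -` B \<inter> space M \<in> sets (BM a)"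
      using measurable_sets[OF borel_measurable_indicator[OF A]] by simp
  qed
  have "indep_set ?SD ?SA"
  proof (rule indep_setI)
    show "?SD \<subseteq> events"
      using measurable_sets[OF D] by auto
    show "?SA \<subseteq> events"
      using SA sets_BM_subset by blast
    fix d c assume "d \<in> ?SD" and c: "c \<in> ?SA"
    then obtain B where B: "B \<in> sets borel" "d = ?D -` B \<inter> space M"
      by blast
    show "prob (d \<inter> c) = prob d * prob c"
      unfolding B(2) by (rule increment_indep_BM[OF assms(1,2) subsetD[OF SA c] B(1)])
  qed
  then show ?thesis
    unfolding indep_var_eq using D A_ev by (intro conjI indep_set_sigma_sets Int_stable_vimage_sets) auto
qed

lemma increment_given_past:
  assumes ab: "0 \<le> a" "a \<le> b" and A: "A \<in> sets (BM a)"
  shows "(LINT \<omega>:A|M. w j b \<omega> - w j a \<omega>) = 0"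
    and "(\<integral>\<^sup>+\<omega>\<in>A. ennreal ((w j b \<omega> - w j a \<omega>)\<^sup>2) \<partial>M) = ennreal (b - a) * emeasure M A"
proof -
  let ?D = "\<lambda>\<omega>. w j b \<omega> - w j a \<omega>"
  have A_ev [measurable]: "A \<in> events"
    using A sets_BM_subset by auto
  have int_A: "integrable M (indicator A :: 'a \<Rightarrow> real)"
    by (simp add: integrable_indicator_iff emeasure_eq_measure)
  note ind = increment_indep_indicator[OF ab A, of j]
  have ind2: "indep_var borel (\<lambda>\<omega>. (?D \<omega>)\<^sup>2) borel (indicator A :: 'a \<Rightarrow> real)"
  proof -
    have "indep_var borel ((\<lambda>x. x\<^sup>2) \<circ> ?D) borel ((\<lambda>x. x) \<circ> (indicator A :: 'a \<Rightarrow> real))"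
      by (rule indep_var_compose[OF ind]) auto
    then show ?thesis
      by (simp only: comp_def)
  qed
  show "(LINT \<omega>:A|M. ?D \<omega>) = 0"
    using indep_var_lebesgue_integral[OF ind increment_moments(1)[OF ab] int_A] increment_moments(2)[OF ab, of j]
    by (simp add: set_lebesgue_integral_def mult.commute)
  have "(\<integral>\<^sup>+\<omega>\<in>A. ennreal ((?D \<omega>)\<^sup>2) \<partial>M) = (\<integral>\<^sup>+\<omega>. ennreal ((?D \<omega>)\<^sup>2 * indicator A \<omega>) \<partial>M)"
    by (intro nn_integral_cong) (simp split: split_indicator)
  also have "\<dots> = ennreal (\<integral>\<omega>. (?D \<omega>)\<^sup>2 * indicator A \<omega> \<partial>M)"
    by (intro nn_integral_eq_integral indep_var_integrable[OF ind2 increment_moments(3)[OF ab] int_A]) simp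
  also have "(\<integral>\<omega>. (?D \<omega>)\<^sup>2 * indicator A \<omega> \<partial>M) = (b - a) * prob A"
    using indep_var_lebesgue_integral[OF ind2 increment_moments(3)[OF ab] int_A] increment_moments(4)[OF ab, of j]
    by simp
  also have "ennreal ((b - a) * prob A) = ennreal (b - a) * emeasure M A"
    using ab by (simp add: ennreal_mult emeasure_eq_measure)
  finally show "(\<integral>\<^sup>+\<omega>\<in>A. ennreal ((?D \<omega>)\<^sup>2) \<partial>M) = ennreal (b - a) * emeasure M A" .
qed

text \<open>Optional sampling at two times with countably many values: on the piece \<open>C i\<close> these times are \<open>a i\<close>
  and \<open>b i\<close>, and \<open>C i\<close> belongs to the past of \<open>a i\<close>, so on each piece the increment from \<open>a i\<close> to \<open>b i\<close>
  has mean zero and second moment \<open>b i - a i\<close>. Random times that are ordered only almost surely may produce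
  pieces on which \<open>b i < a i\<close>; these are null sets.\<close>

lemma countable_sampling:
  fixes C :: "nat \<Rightarrow> 'a set" and a b :: "nat \<Rightarrow> real"
  assumes C: "\<And>i. C i \<in> sets (BM (a i))" "disjoint_family C"
    and a: "\<And>i. 0 \<le> a i" and ab: "\<And>i. AE \<omega> in M. \<omega> \<in> C i \<longrightarrow> a i \<le> b i"
    and [measurable]: "Z \<in> borel_measurable M" "V \<in> borel_measurable M"
    and Z: "\<And>i \<omega>. \<omega> \<in> C i \<Longrightarrow> Z \<omega> = w j (b i) \<omega> - w j (a i) \<omega>"
    and V: "\<And>i \<omega>. \<omega> \<in> C i \<Longrightarrow> V \<omega> = b i - a i"
  shows "(\<integral>\<^sup>+\<omega>\<in>(\<Union>i. C i). ennreal ((Z \<omega>)\<^sup>2) \<partial>M) = (\<integral>\<^sup>+\<omega>\<in>(\<Union>i. C i). ennreal (V \<omega>) \<partial>M)"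
    and "set_integrable M (\<Union>i. C i) Z \<Longrightarrow> (LINT \<omega>:(\<Union>i. C i)|M. Z \<omega>) = 0"
proof -
  have C_ev [measurable]: "C i \<in> events" for i
    using C sets_BM_subset by auto
  have null: "C i \<in> null_sets M" if "\<not> a i \<le> b i" for i
    using ab[of i] that sets.sets_into_space[OF C_ev[of i]] by (auto simp: null_sets_iff_AE)
  have sq: "(\<integral>\<^sup>+\<omega>\<in>C i. ennreal ((Z \<omega>)\<^sup>2) \<partial>M) = (\<integral>\<^sup>+\<omega>\<in>C i. ennreal (V \<omega>) \<partial>M)" for i
  proof (cases "a i \<le> b i")
    case True
    have "(\<integral>\<^sup>+\<omega>\<in>C i. ennreal ((Z \<omega>)\<^sup>2) \<partial>M) = (\<integral>\<^sup>+\<omega>\<in>C i. ennreal ((w j (b i) \<omega> - w j (a i) \<omega>)\<^sup>2) \<partial>M)"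
      by (intro nn_integral_cong) (simp add: Z split: split_indicator)
    also have "\<dots> = ennreal (b i - a i) * emeasure M (C i)"
      by (rule increment_given_past[OF a True C(1)])
    also have "\<dots> = (\<integral>\<^sup>+\<omega>\<in>C i. ennreal (b i - a i) \<partial>M)"
      by (rule nn_integral_cmult_indicator[symmetric, OF C_ev])
    also have "\<dots> = (\<integral>\<^sup>+\<omega>\<in>C i. ennreal (V \<omega>) \<partial>M)"
      by (intro nn_integral_cong) (simp add: V split: split_indicator)
    finally show ?thesis .
  next
    case False
    show ?thesis
      unfolding nn_integral_null_set[OF null[OF False]] ..
  qed
  show "(\<integral>\<^sup>+\<omega>\<in>(\<Union>i. C i). ennreal ((Z \<omega>)\<^sup>2) \<partial>M) = (\<integral>\<^sup>+\<omega>\<in>(\<Union>i. C i). ennreal (V \<omega>) \<partial>M)"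
    by (subst (1 2) nn_integral_disjoint_family[OF _ C_ev C(2)]) (simp_all only: sq, measurable)
  have "(LINT \<omega>:C i|M. Z \<omega>) = 0" for i
  proof (cases "a i \<le> b i")
    case True
    have "(LINT \<omega>:C i|M. Z \<omega>) = (LINT \<omega>:C i|M. w j (b i) \<omega> - w j (a i) \<omega>)"
      by (intro set_lebesgue_integral_cong C_ev allI impI Z)
    then show ?thesis
      using increment_given_past(1)[OF a True C(1)] by simp
  next
    case False
    have "AE \<omega> in M. indicat_real (C i) \<omega> *\<^sub>R Z \<omega> = 0"
      using AE_not_in[OF null[OF False]] by eventually_elim auto
    then show ?thesis
      unfolding set_lebesgue_integral_def by (rule integral_eq_zero_AE)
  qed
  moreover have "\<And>i j. i \<noteq> j \<Longrightarrow> C i \<inter> C j = {}"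
    using C(2) by (auto simp: disjoint_family_on_def)
  ultimately show "(LINT \<omega>:(\<Union>i. C i)|M. Z \<omega>) = 0" if "set_integrable M (\<Union>i. C i) Z"
    using lebesgue_integral_countable_add[OF C_ev _ that] by simp
qed

end

section \<open>Dyadic times and the time-changed filtration\<close>

text \<open>The first multiple of \<open>2\<^sup>-\<^sup>n\<close> that is strictly greater than \<open>x\<close> (for \<open>x \<ge> 0\<close>). Because of the strictness,
  a clock whose grid point is \<open>a\<close> is strictly less than \<open>a\<close>, so that the past at time \<open>a\<close> already contains
  what a right-continuous filtration knows at the clock.\<close>

definition grid :: "nat \<Rightarrow> real \<Rightarrow> real" where
  "grid n x = (real (nat \<lfloor>2 ^ n * x\<rfloor>) + 1) / 2 ^ n"

lemma grid_pos: "0 < grid n x"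
  by (simp add: grid_def add_nonneg_pos)

lemma less_grid: "x < grid n x"
proof -
  have "2 ^ n * x < real (nat \<lfloor>2 ^ n * x\<rfloor>) + 1"
    by linarith
  then show ?thesis
    by (simp add: grid_def field_simps)
qed

lemma grid_le: "0 \<le> x \<Longrightarrow> grid n x \<le> x + 1 / 2 ^ n"
proof -
  assume "0 \<le> x"
  then have "real (nat \<lfloor>2 ^ n * x\<rfloor>) \<le> 2 ^ n * x"
    by simp
  then show ?thesis
    by (simp add: grid_def field_simps)
qed

lemma grid_mono: "x \<le> y \<Longrightarrow> grid n x \<le> grid n y"
  unfolding grid_def
  by (intro divide_right_mono add_right_mono of_nat_mono nat_mono floor_mono mult_left_mono) auto

lemma grid_antimono:
  assumes "m \<le> n"
  shows "grid n x \<le> grid m x"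
  using assms
proof (induction rule: dec_induct)
  case (step n)
  define k where "k = nat \<lfloor>2 ^ n * x\<rfloor>"
  have "2 ^ n * x < real k + 1"
    unfolding k_def by linarith
  then have "2 ^ Suc n * x < real (2 * k + 2)"
    by simp
  then have "nat \<lfloor>2 ^ Suc n * x\<rfloor> \<le> 2 * k + 1"
    by linarith
  then have "real (nat \<lfloor>2 ^ Suc n * x\<rfloor>) \<le> real (2 * k + 1)"
    by (rule of_nat_mono)
  moreover have "real (2 * k + 1) + 1 = 2 * (real k + 1)"
    by simp
  ultimately have "real (nat \<lfloor>2 ^ Suc n * x\<rfloor>) + 1 \<le> 2 * (real k + 1)"
    by linarith
  then have "grid (Suc n) x \<le> 2 * (real k + 1) / 2 ^ Suc n"
    unfolding grid_def by (intro divide_right_mono) auto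
  also have "\<dots> = grid n x"
    by (simp add: grid_def k_def field_simps)
  finally show ?case
    using step.IH by simp
qed simp

lemma grid_tendsto:
  assumes "0 \<le> x"
  shows "(\<lambda>n. grid n x) \<longlonglongrightarrow> x"
proof (rule real_tendsto_sandwich)
  show "\<forall>\<^sub>F n in sequentially. x \<le> grid n x"
    by (simp add: less_imp_le less_grid)
  show "\<forall>\<^sub>F n in sequentially. grid n x \<le> x + (1 / 2) ^ n"
    using grid_le[OF assms] by (simp add: power_one_over)
  show "(\<lambda>n. x + (1 / 2) ^ n) \<longlonglongrightarrow> x"
    using tendsto_add[OF tendsto_const[of x] LIMSEQ_power_zero[of "1 / 2 :: real"]] by simp
qed simp

lemma borel_measurable_grid [measurable]: "grid n \<in> borel_measurable borel"
  unfolding grid_def by measurable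

context independent_clock begin

abbreviation FF :: "real \<Rightarrow> 'a measure" where
  "FF \<equiv> tilde_F M w E"

abbreviation GG :: "real \<Rightarrow> 'a measure" where
  "GG \<equiv> time_changed_filtration M w E"

lemma space_FF [simp]: "space (FF t) = space M"
  by (simp add: tilde_F_def space_measure_of_conv)

lemma sets_FF: "sets (FF t) = (\<Inter>u\<in>{t<..}. sets (BM u))"
proof -
  let ?I = "\<Inter>u\<in>{t<..}. sets (BM u)"
  have "?I \<subseteq> sets (BM (t + 1))"
    by (intro INF_lower) simp
  then have "?I \<subseteq> Pow (space M)"
    using sets.space_closed[of "BM (t + 1)"] by auto
  then have "sets (FF t) = sigma_sets (space M) ?I"
    unfolding tilde_F_def by (rule sets_measure_of)
  also have "\<dots> = ?I"
  proof (intro antisym INF_greatest)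
    fix u assume "u \<in> {t<..}"
    then have "?I \<subseteq> sets (BM u)"
      by (rule INF_lower)
    then show "sigma_sets (space M) ?I \<subseteq> sets (BM u)"
      using sets.sigma_sets_subset[of ?I "BM u"] by simp
  qed (rule sigma_sets_superset_generator)
  finally show ?thesis .
qed

lemma BM_subset_FF: "sets (BM t) \<subseteq> sets (FF t)"
  unfolding sets_FF using sets_BM_mono by (auto intro: less_imp_le)

lemma FF_subset_BM: "t < u \<Longrightarrow> sets (FF t) \<subseteq> sets (BM u)"
  unfolding sets_FF by auto

lemma FF_subset: "sets (FF t) \<subseteq> sets M"
  using FF_subset_BM[of t "t + 1"] sets_BM_subset[of "t + 1"] by simp

sublocale FF: filtration "space M" FF
  by standard (auto simp: sets_FF)

text \<open>The whole clock belongs to the information available at every time.\<close>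

lemma E_stopping_time: "0 \<le> t \<Longrightarrow> stopping_time FF (E t)"
proof
  fix r assume "0 \<le> t"
  then have "{\<omega>\<in>space (BM r). E t \<omega> \<le> r} \<in> sets (BM r)"
    by measurable
  then show "Measurable.pred (FF r) (\<lambda>\<omega>. E t \<omega> \<le> r)"
    unfolding pred_def using BM_subset_FF by auto
qed

lemma space_GG [simp]: "space (GG t) = space M"
  by (simp add: time_changed_filtration_def FF.space_pre_sigma)

lemma sets_GG: "0 \<le> t \<Longrightarrow> A \<in> sets (GG t) \<longleftrightarrow> (\<forall>r. {\<omega>\<in>A. E t \<omega> \<le> r} \<in> sets (FF r))"
  by (simp add: time_changed_filtration_def FF.sets_pre_sigma[OF E_stopping_time])

lemma GG_subset:
  assumes "0 \<le> t"
  shows "sets (GG t) \<subseteq> sets M"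
proof
  fix A assume "A \<in> sets (GG t)"
  then have "(\<Union>n::nat. {\<omega>\<in>A. E t \<omega> \<le> real n}) \<in> sets M"
    using sets_GG[OF assms] FF_subset by blast
  moreover have "(\<Union>n::nat. {\<omega>\<in>A. E t \<omega> \<le> real n}) = A"
    using real_arch_simple by blast
  ultimately show "A \<in> sets M"
    by simp
qed

text \<open>The event is the union over \<open>n\<close> of the events \<open>E t \<le> r - 1 / (n + 1)\<close> in \<open>A\<close>, and what is known
  immediately after time \<open>r - 1 / (n + 1)\<close> is known at time \<open>r\<close>. So the strict inequality absorbs the right
  limit in the filtration.\<close>

lemma GG_less:
  assumes "0 \<le> t" and A: "A \<in> sets (GG t)"
  shows "{\<omega>\<in>A. E t \<omega> < r} \<in> sets (BM r)"
proof -
  have "{\<omega>\<in>A. E t \<omega> \<le> r - 1 / real (Suc n)} \<in> sets (BM r)" for n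
    using A sets_GG[OF assms(1)] FF_subset_BM[of "r - 1 / real (Suc n)" r] by auto
  then have "(\<Union>n. {\<omega>\<in>A. E t \<omega> \<le> r - 1 / real (Suc n)}) \<in> sets (BM r)"
    by blast
  moreover have "(\<Union>n. {\<omega>\<in>A. E t \<omega> \<le> r - 1 / real (Suc n)}) = {\<omega>\<in>A. E t \<omega> < r}"
  proof safe
    fix \<omega> n assume "E t \<omega> \<le> r - 1 / real (Suc n)"
    moreover have "0 < 1 / real (Suc n)"
      by simp
    ultimately show "E t \<omega> < r"
      by linarith
  next
    fix \<omega> assume "\<omega> \<in> A" "E t \<omega> < r"
    then obtain n where "inverse (real (Suc n)) < r - E t \<omega>"
      using reals_Archimedean[of "r - E t \<omega>"] by auto
    then have "E t \<omega> \<le> r - 1 / real (Suc n)"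
      by (simp add: inverse_eq_divide)
    then show "\<omega> \<in> (\<Union>n. {\<omega>\<in>A. E t \<omega> \<le> r - 1 / real (Suc n)})"
      using \<open>\<omega> \<in> A\<close> by blast
  qed
  ultimately show ?thesis
    by simp
qed

text \<open>Up to a null set, which belongs to all the \<open>\<sigma>\<close>-fields, \<open>E t \<le> r\<close> is possible only where \<open>E s \<le> r\<close>.\<close>

lemma GG_mono:
  assumes "0 \<le> s" "s \<le> t"
  shows "sets (GG s) \<subseteq> sets (GG t)"
proof
  fix A assume A: "A \<in> sets (GG s)"
  have t: "0 \<le> t"
    using assms by simp
  show "A \<in> sets (GG t)"
    unfolding sets_GG[OF t]
  proof
    fix r
    have "{\<omega>\<in>A. E s \<omega> \<le> r} \<inter> {\<omega>\<in>space M. E t \<omega> \<le> r} \<in> sets (BM u)" if "r < u" for u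
    proof -
      have "{\<omega>\<in>A. E s \<omega> \<le> r} \<in> sets (BM u)"
        using A sets_GG[OF assms(1)] FF_subset_BM[OF that] by auto
      moreover have "{\<omega>\<in>space (BM u). E t \<omega> \<le> r} \<in> sets (BM u)"
        using t by measurable
      ultimately show ?thesis
        by auto
    qed
    then have "{\<omega>\<in>A. E t \<omega> \<le> r} \<in> sets (BM u)" if "r < u" for u
    proof (rule sets_BM_AE_cong)
      show "AE \<omega> in M. \<omega> \<in> {\<omega> \<in> A. E s \<omega> \<le> r} \<inter> {\<omega> \<in> space M. E t \<omega> \<le> r} \<longleftrightarrow>
          \<omega> \<in> {\<omega> \<in> A. E t \<omega> \<le> r}"
        using E_mono[OF assms] AE_space by eventually_elim auto
      show "{\<omega> \<in> A. E t \<omega> \<le> r} \<subseteq> space M"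
        using sets.sets_into_space[OF A] by auto
    qed (use that in auto)
    then show "{\<omega>\<in>A. E t \<omega> \<le> r} \<in> sets (FF r)"
      by (simp add: sets_FF)
  qed
qed

text \<open>By continuity of the paths the value at the time \<open>c\<close> is a limit of values at grid points, of which
  there are countably many. The grid approximates \<open>c\<close> from above; taking the minimum with \<open>r\<close> keeps it from
  looking into the future.\<close>

lemma w_at_time_measurable_BM:
  assumes c [measurable]: "c \<in> borel_measurable (BM r)" and "0 \<le> r"
    and bounds: "AE \<omega> in M. 0 \<le> c \<omega> \<and> c \<omega> \<le> r"
  shows "(\<lambda>\<omega>. w j (c \<omega>) \<omega>) \<in> borel_measurable (BM r)"
proof -
  let ?g = "\<lambda>n x. min (grid n x) r"
  have "(\<lambda>\<omega>. (\<lambda>k \<omega>. w j (min ((real k + 1) / 2 ^ n) r) \<omega>) (nat \<lfloor>2 ^ n * c \<omega>\<rfloor>) \<omega>) \<in> borel_measurable (BM r)" for n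
    by (rule measurable_compose_countable) (auto intro!: w_measurable_BM simp: \<open>0 \<le> r\<close>)
  then have "(\<lambda>\<omega>. w j (?g n (c \<omega>)) \<omega>) \<in> borel_measurable (BM r)" for n
    by (simp add: grid_def)
  then have "(\<lambda>\<omega>. lim (\<lambda>n. w j (?g n (c \<omega>)) \<omega>)) \<in> borel_measurable (BM r)"
    by measurable
  moreover have "AE \<omega> in M. lim (\<lambda>n. w j (?g n (c \<omega>)) \<omega>) = w j (c \<omega>) \<omega>"
    using bounds w_continuous[of j]
  proof eventually_elim
    case (elim \<omega>)
    then have "(\<lambda>n. ?g n (c \<omega>)) \<longlonglongrightarrow> min (c \<omega>) r"
      by (intro tendsto_intros grid_tendsto) auto
    then have "(\<lambda>n. w j (?g n (c \<omega>)) \<omega>) \<longlonglongrightarrow> w j (c \<omega>) \<omega>"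
      using elim \<open>0 \<le> r\<close> less_imp_le[OF grid_pos]
      by (intro continuous_on_tendsto_compose[of "{0..}" "\<lambda>t. w j t \<omega>"]) (auto simp: min_def)
    then show ?case
      by (rule limI)
  qed
  ultimately show ?thesis
    by (rule measurable_BM_AE_cong)
qed

text \<open>On the event \<open>E t \<le> r\<close> the clock can be replaced by \<open>min (E t) r\<close>, a time that does not exceed \<open>r\<close>.\<close>

lemma w_clock_measurable_GG:
  assumes t: "0 \<le> t"
  shows "(\<lambda>\<omega>. w j (E t \<omega>) \<omega>) \<in> borel_measurable (GG t)"
proof (rule measurableI)
  fix B assume B: "B \<in> sets (borel :: real measure)"
  have "{\<omega>\<in>space M. w j (E t \<omega>) \<omega> \<in> B \<and> E t \<omega> \<le> r} \<in> sets (BM r)" for r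
  proof (cases "0 \<le> r")
    case True
    have "(\<lambda>\<omega>. w j (min (E t \<omega>) r) \<omega>) \<in> borel_measurable (BM r)"
      using t True E_nonneg[OF t] by (intro w_at_time_measurable_BM) auto
    moreover have "E t \<in> borel_measurable (BM r)"
      using t by measurable
    ultimately have "{\<omega>\<in>space (BM r). w j (min (E t \<omega>) r) \<omega> \<in> B \<and> E t \<omega> \<le> r} \<in> sets (BM r)"
      using B by measurable
    moreover have "{\<omega>\<in>space (BM r). w j (min (E t \<omega>) r) \<omega> \<in> B \<and> E t \<omega> \<le> r} =
        {\<omega>\<in>space M. w j (E t \<omega>) \<omega> \<in> B \<and> E t \<omega> \<le> r}"
      by (auto simp: min_def)
    ultimately show ?thesis
      by simp
  next
    case False
    \<comment> \<open>The clock is almost surely nonnegative, so for negative \<open>r\<close> the event is a null set.\<close>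
    have "AE \<omega> in M. \<omega> \<notin> {\<omega>\<in>space M. w j (E t \<omega>) \<omega> \<in> B \<and> E t \<omega> \<le> r}"
      using E_nonneg[OF t] by eventually_elim (use False in auto)
    then show ?thesis
      by (intro null_sets_BM) (auto simp: null_sets_iff_AE)
  qed
  then show "(\<lambda>\<omega>. w j (E t \<omega>) \<omega>) -` B \<inter> space (GG t) \<in> sets (GG t)"
    unfolding sets_GG[OF t] using BM_subset_FF by (auto simp: vimage_def Int_def conj_ac)
qed auto

lemma w_grid_measurable [measurable]:
  assumes [measurable]: "c \<in> borel_measurable M"
  shows "(\<lambda>\<omega>. w j (grid n (c \<omega>)) \<omega>) \<in> borel_measurable M"
proof -
  have "(\<lambda>\<omega>. (\<lambda>k \<omega>. w j ((real k + 1) / 2 ^ n) \<omega>) (nat \<lfloor>2 ^ n * c \<omega>\<rfloor>) \<omega>) \<in> borel_measurable M"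
    by (rule measurable_compose_countable) (auto intro!: w_measurable)
  then show ?thesis
    by (simp add: grid_def)
qed

lemma w_grid_tendsto:
  assumes "0 \<le> t"
  shows "AE \<omega> in M. (\<lambda>n. w j (grid n (E t \<omega>)) \<omega>) \<longlonglongrightarrow> w j (E t \<omega>) \<omega>"
  using E_nonneg[OF assms] w_continuous[of j]
proof eventually_elim
  case (elim \<omega>)
  then show ?case
    using less_imp_le[OF grid_pos] grid_tendsto
    by (intro continuous_on_tendsto_compose[of "{0..}" "\<lambda>t. w j t \<omega>"]) auto
qed

end

section \<open>Optional sampling at the clock\<close>

text \<open>Fatou's lemma for second moments.\<close>

lemma nn_integral_square_le_of_AE_tendsto:
  fixes Y :: "nat \<Rightarrow> 'a \<Rightarrow> real"
  assumes meas: "\<And>n. Y n \<in> borel_measurable M"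
    and lim: "AE \<omega> in M. (\<lambda>n. Y n \<omega>) \<longlonglongrightarrow> Z \<omega>"
    and bound: "\<forall>\<^sub>F n in sequentially. (\<integral>\<^sup>+\<omega>. ennreal ((Y n \<omega>)\<^sup>2) \<partial>M) \<le> K"
  shows "(\<integral>\<^sup>+\<omega>. ennreal ((Z \<omega>)\<^sup>2) \<partial>M) \<le> K"
proof -
  have "(\<integral>\<^sup>+\<omega>. ennreal ((Z \<omega>)\<^sup>2) \<partial>M) = (\<integral>\<^sup>+\<omega>. liminf (\<lambda>n. ennreal ((Y n \<omega>)\<^sup>2)) \<partial>M)"
  proof (rule nn_integral_cong_AE)
    show "AE \<omega> in M. ennreal ((Z \<omega>)\<^sup>2) = liminf (\<lambda>n. ennreal ((Y n \<omega>)\<^sup>2))"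
      using lim
    proof eventually_elim
      case (elim \<omega>)
      then have "(\<lambda>n. ennreal ((Y n \<omega>)\<^sup>2)) \<longlonglongrightarrow> ennreal ((Z \<omega>)\<^sup>2)"
        by (intro tendsto_ennrealI tendsto_power)
      then show ?case
        by (intro lim_imp_Liminf[symmetric] trivial_limit_sequentially)
    qed
  qed
  also have "\<dots> \<le> liminf (\<lambda>n. \<integral>\<^sup>+\<omega>. ennreal ((Y n \<omega>)\<^sup>2) \<partial>M)"
    using meas by (intro nn_integral_liminf) simp
  also have "\<dots> \<le> K"
    by (rule Liminf_le[OF trivial_limit_sequentially bound])
  finally show ?thesis .
qed

text \<open>The bound on the first absolute moment expresses that the variance of \<open>\<bar>Z\<bar>\<close> is nonnegative.\<close>

lemma (in prob_space) integrable_of_square_bound: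
  fixes Z :: "'a \<Rightarrow> real"
  assumes [measurable]: "Z \<in> borel_measurable M"
    and bound: "(\<integral>\<^sup>+\<omega>. ennreal ((Z \<omega>)\<^sup>2) \<partial>M) \<le> ennreal K" and K: "0 \<le> K"
  shows "integrable M Z" and "integrable M (\<lambda>\<omega>. (Z \<omega>)\<^sup>2)"
    and "expectation (\<lambda>\<omega>. \<bar>Z \<omega>\<bar>) \<le> sqrt K"
proof -
  show sq: "integrable M (\<lambda>\<omega>. (Z \<omega>)\<^sup>2)"
    using bound by (intro integrableI_nonneg) (auto intro: order_le_less_trans ennreal_less_top)
  show int: "integrable M Z"
    by (rule square_integrable_imp_integrable) (use sq in auto)
  have "0 \<le> variance (\<lambda>\<omega>. \<bar>Z \<omega>\<bar>)"
    by (rule variance_positive)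
  also have "\<dots> = expectation (\<lambda>\<omega>. (Z \<omega>)\<^sup>2) - (expectation (\<lambda>\<omega>. \<bar>Z \<omega>\<bar>))\<^sup>2"
    using int sq by (subst variance_eq) auto
  finally have "(expectation (\<lambda>\<omega>. \<bar>Z \<omega>\<bar>))\<^sup>2 \<le> expectation (\<lambda>\<omega>. (Z \<omega>)\<^sup>2)"
    by simp
  also have "ennreal (expectation (\<lambda>\<omega>. (Z \<omega>)\<^sup>2)) \<le> ennreal K"
    using bound nn_integral_eq_integral[OF sq] by simp
  then have "expectation (\<lambda>\<omega>. (Z \<omega>)\<^sup>2) \<le> K"
    using K by simp
  finally show "expectation (\<lambda>\<omega>. \<bar>Z \<omega>\<bar>) \<le> sqrt K"
    by (rule real_le_rsqrt)
qed

context independent_clock begin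

text \<open>Cut \<open>A\<close> into pieces according to the grid points of \<open>E s\<close> and \<open>E t\<close>. A piece on which the grid point of
  \<open>E s\<close> is \<open>a\<close> belongs to the past of \<open>a\<close>: the part concerning \<open>A\<close> and \<open>E s\<close> by \<open>GG_less\<close>, and the part
  concerning \<open>E t\<close> since the clock is known from the beginning. So \<open>countable_sampling\<close> applies.\<close>

lemma grid_sampling:
  fixes j m n :: nat
  assumes s: "0 \<le> s" and t: "0 \<le> t" and A: "A \<in> sets (GG s)"
    and le: "AE \<omega> in M. grid m (E s \<omega>) \<le> grid n (E t \<omega>)"
  defines "Z \<equiv> \<lambda>\<omega>. w j (grid n (E t \<omega>)) \<omega> - w j (grid m (E s \<omega>)) \<omega>"
  shows "(\<integral>\<^sup>+\<omega>\<in>A. ennreal ((Z \<omega>)\<^sup>2) \<partial>M) =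
         (\<integral>\<^sup>+\<omega>\<in>A. ennreal (grid n (E t \<omega>) - grid m (E s \<omega>)) \<partial>M)"
    and "set_integrable M A Z \<Longrightarrow> (LINT \<omega>:A|M. Z \<omega>) = 0"
proof -
  let ?k = "\<lambda>\<omega>. nat \<lfloor>2 ^ m * E s \<omega>\<rfloor>" and ?l = "\<lambda>\<omega>. nat \<lfloor>2 ^ n * E t \<omega>\<rfloor>"
  \<comment> \<open>Pieces are numbered by the encoded pairs of grid indices of \<open>E s\<close> and \<open>E t\<close>.\<close>
  define a b where "a p = (real (fst (prod_decode p)) + 1) / 2 ^ m"
    and "b p = (real (snd (prod_decode p)) + 1) / 2 ^ n" for p
  define C where "C p = {\<omega>\<in>A. ?k \<omega> = fst (prod_decode p) \<and> ?l \<omega> = snd (prod_decode p)}" for p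
  have A_space: "A \<subseteq> space M"
    using sets.sets_into_space[OF A] by simp
  have on_C: "grid m (E s \<omega>) = a p" "grid n (E t \<omega>) = b p" if "\<omega> \<in> C p" for \<omega> p
    using that by (auto simp: C_def a_def b_def grid_def)
  have C_BM: "C p \<in> sets (BM (a p))" for p
  proof -
    have "{\<omega>\<in>space (BM (a p)). ?k \<omega> = fst (prod_decode p) \<and> ?l \<omega> = snd (prod_decode p)} \<in> sets (BM (a p))"
      using s t by measurable
    then have "{\<omega>\<in>A. E s \<omega> < a p} \<inter>
        {\<omega>\<in>space M. ?k \<omega> = fst (prod_decode p) \<and> ?l \<omega> = snd (prod_decode p)} \<in> sets (BM (a p))"
      using GG_less[OF s A] by auto
    moreover have "E s \<omega> < a p" if "\<omega> \<in> C p" for \<omega>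
      using less_grid[of "E s \<omega>" m] on_C(1)[OF that] by simp
    then have "{\<omega>\<in>A. E s \<omega> < a p} \<inter>
        {\<omega>\<in>space M. ?k \<omega> = fst (prod_decode p) \<and> ?l \<omega> = snd (prod_decode p)} = C p"
      using A_space by (auto simp: C_def)
    ultimately show ?thesis
      by simp
  qed
  have disj: "disjoint_family C"
  proof -
    have "p = q" if "\<omega> \<in> C p" "\<omega> \<in> C q" for \<omega> p q
    proof -
      have "prod_decode p = prod_decode q"
        using that by (auto simp: C_def prod_eq_iff)
      then show "p = q"
        by simp
    qed
    then show ?thesis
      unfolding disjoint_family_on_def by blast
  qed
  have UN: "(\<Union>p. C p) = A"
  proof
    show "A \<subseteq> (\<Union>p. C p)"
    proof
      fix \<omega> assume "\<omega> \<in> A"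
      then have "\<omega> \<in> C (prod_encode (?k \<omega>, ?l \<omega>))"
        by (simp add: C_def)
      then show "\<omega> \<in> (\<Union>p. C p)"
        by blast
    qed
  qed (auto simp: C_def)
  have a: "0 \<le> a p" for p
    by (simp add: a_def)
  have ab: "AE \<omega> in M. \<omega> \<in> C p \<longrightarrow> a p \<le> b p" for p
    using le by eventually_elim (auto simp: on_C)
  have Z: "Z \<in> borel_measurable M"
    unfolding Z_def using s t by measurable
  have V: "(\<lambda>\<omega>. grid n (E t \<omega>) - grid m (E s \<omega>)) \<in> borel_measurable M"
    using s t by measurable
  note samp = countable_sampling[of C a b Z "\<lambda>\<omega>. grid n (E t \<omega>) - grid m (E s \<omega>)" j, OF C_BM disj a ab Z V]
  show "(\<integral>\<^sup>+\<omega>\<in>A. ennreal ((Z \<omega>)\<^sup>2) \<partial>M) =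
         (\<integral>\<^sup>+\<omega>\<in>A. ennreal (grid n (E t \<omega>) - grid m (E s \<omega>)) \<partial>M)"
    using samp(1) by (simp add: UN Z_def on_C)
  show "(LINT \<omega>:A|M. Z \<omega>) = 0" if "set_integrable M A Z"
    using samp(2) that by (simp add: UN Z_def on_C)
qed

lemma w_clock_measurable [measurable]: "0 \<le> t \<Longrightarrow> (\<lambda>\<omega>. w j (E t \<omega>) \<omega>) \<in> borel_measurable M"
  by (rule subsetD[OF measurable_mono w_clock_measurable_GG]) (simp_all add: GG_subset)

text \<open>Compared with a finer grid the mean square error is exactly the mean distance of the two grid points,
  which is at most \<open>2\<^sup>-\<^sup>n\<close>; by Fatou the bound survives when the finer grid shrinks to the clock.\<close>

lemma w_grid_L2:
  assumes t: "0 \<le> t"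
  shows "(\<integral>\<^sup>+\<omega>. ennreal ((w j (grid n (E t \<omega>)) \<omega> - w j (E t \<omega>) \<omega>)\<^sup>2) \<partial>M) \<le> ennreal (1 / 2 ^ n)"
proof (rule nn_integral_square_le_of_AE_tendsto)
  show "(\<lambda>\<omega>. w j (grid n (E t \<omega>)) \<omega> - w j (grid m (E t \<omega>)) \<omega>) \<in> borel_measurable M" for m
    using t by measurable
  show "AE \<omega> in M. (\<lambda>m. w j (grid n (E t \<omega>)) \<omega> - w j (grid m (E t \<omega>)) \<omega>)
      \<longlonglongrightarrow> w j (grid n (E t \<omega>)) \<omega> - w j (E t \<omega>) \<omega>"
    using w_grid_tendsto[OF t] by eventually_elim (intro tendsto_intros)
  show "\<forall>\<^sub>F m in sequentially.
      (\<integral>\<^sup>+\<omega>. ennreal ((w j (grid n (E t \<omega>)) \<omega> - w j (grid m (E t \<omega>)) \<omega>)\<^sup>2) \<partial>M) \<le> ennreal (1 / 2 ^ n)"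
    using eventually_ge_at_top[of n]
  proof eventually_elim
    case (elim m)
    have "space M \<in> sets (GG t)"
      using sets.top[of "GG t"] by simp
    from grid_sampling(1)[OF t t this, of m n j]
    have "(\<integral>\<^sup>+\<omega>. ennreal ((w j (grid n (E t \<omega>)) \<omega> - w j (grid m (E t \<omega>)) \<omega>)\<^sup>2) \<partial>M) =
        (\<integral>\<^sup>+\<omega>\<in>space M. ennreal (grid n (E t \<omega>) - grid m (E t \<omega>)) \<partial>M)"
      using grid_antimono[OF elim] by (simp add: nn_set_integral_space)
    also have "\<dots> \<le> (\<integral>\<^sup>+\<omega>. ennreal (1 / 2 ^ n) \<partial>M)"
    proof (rule nn_integral_mono_AE)
      show "AE \<omega> in M. ennreal (grid n (E t \<omega>) - grid m (E t \<omega>)) * indicator (space M) \<omega> \<le> ennreal (1 / 2 ^ n)"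
        using E_nonneg[OF t]
      proof eventually_elim
        case (elim \<omega>)
        then show ?case
          using grid_le[of "E t \<omega>" n] less_grid[of "E t \<omega>" m]
          by (auto intro!: ennreal_leI split: split_indicator)
      qed
    qed
    also have "\<dots> = ennreal (1 / 2 ^ n)"
      by (simp add: emeasure_space_1)
    finally show ?case .
  qed
qed

text \<open>Here the sampled times are \<open>0\<close> and the grid point of \<open>E t\<close>. The pieces on which this grid point is
  constant belong to the past of \<open>0\<close>, as they are events of the clock. The summand \<open>1\<close> bounds the mesh of
  the grid. The bound does not depend on \<open>j\<close>, so the coordinates of a series with summable weights
  can be added up.\<close>

lemma w_clock_second_moment:
  assumes t: "0 \<le> t"
  shows "(\<integral>\<^sup>+\<omega>. ennreal ((w j (E t \<omega>) \<omega>)\<^sup>2) \<partial>M) \<le> ennreal (expectation (E t) + 1)"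
proof (rule nn_integral_square_le_of_AE_tendsto)
  let ?Z = "\<lambda>n \<omega>. w j (grid n (E t \<omega>)) \<omega> - w j 0 \<omega>"
  show meas: "?Z n \<in> borel_measurable M" for n
    using t by measurable
  show "AE \<omega> in M. (\<lambda>n. ?Z n \<omega>) \<longlonglongrightarrow> w j (E t \<omega>) \<omega>"
    using w_grid_tendsto[OF t, of j] w_start[of j]
    by eventually_elim (auto intro!: tendsto_eq_intros)
  have "(\<integral>\<^sup>+\<omega>. ennreal ((?Z n \<omega>)\<^sup>2) \<partial>M) \<le> ennreal (expectation (E t) + 1)" for n
  proof -
    let ?l = "\<lambda>\<omega>. nat \<lfloor>2 ^ n * E t \<omega>\<rfloor>"
    define C where "C l = {\<omega>\<in>space (BM 0). ?l \<omega> = l}" for l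
    have on_C: "grid n (E t \<omega>) = (real l + 1) / 2 ^ n" if "\<omega> \<in> C l" for l \<omega>
      using that by (simp add: C_def grid_def)
    have C: "C l \<in> sets (BM 0)" for l
      unfolding C_def using t by measurable
    have disj: "disjoint_family C"
      by (auto simp: disjoint_family_on_def C_def)
    have V: "(\<lambda>\<omega>. grid n (E t \<omega>)) \<in> borel_measurable M"
      using t by measurable
    have "(\<integral>\<^sup>+\<omega>\<in>(\<Union>l. C l). ennreal ((?Z n \<omega>)\<^sup>2) \<partial>M) =
        (\<integral>\<^sup>+\<omega>\<in>(\<Union>l. C l). ennreal (grid n (E t \<omega>)) \<partial>M)"
      by (rule countable_sampling(1)[where a = "\<lambda>_. 0" and b = "\<lambda>l. (real l + 1) / 2 ^ n" and j = j])
        (auto simp: C on_C meas V disj)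
    moreover have "(\<Union>l. C l) = space M"
      by (auto simp: C_def)
    ultimately have "(\<integral>\<^sup>+\<omega>. ennreal ((?Z n \<omega>)\<^sup>2) \<partial>M) = (\<integral>\<^sup>+\<omega>. ennreal (grid n (E t \<omega>)) \<partial>M)"
      by (simp add: nn_set_integral_space)
    also have "\<dots> \<le> (\<integral>\<^sup>+\<omega>. ennreal (E t \<omega> + 1) \<partial>M)"
    proof (rule nn_integral_mono_AE)
      show "AE \<omega> in M. ennreal (grid n (E t \<omega>)) \<le> ennreal (E t \<omega> + 1)"
        using E_nonneg[OF t]
      proof eventually_elim
        case (elim \<omega>)
        have "1 / 2 ^ n \<le> (1::real)"
          by simp
        then show ?case
          using grid_le[OF elim, of n] by (intro ennreal_leI) linarith
      qed
    qed
    also have "\<dots> = ennreal (expectation (\<lambda>\<omega>. E t \<omega> + 1))"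
      using E_nonneg[OF t] E_integrable[OF t] by (intro nn_integral_eq_integral) auto
    also have "expectation (\<lambda>\<omega>. E t \<omega> + 1) = expectation (E t) + 1"
      using E_integrable[OF t] by (simp add: prob_space)
    finally show ?thesis .
  qed
  then show "\<forall>\<^sub>F n in sequentially. (\<integral>\<^sup>+\<omega>. ennreal ((?Z n \<omega>)\<^sup>2) \<partial>M) \<le> ennreal (expectation (E t) + 1)"
    by simp
qed

lemma expectation_E_nonneg: "0 \<le> t \<Longrightarrow> 0 \<le> expectation (E t)"
  by (rule integral_nonneg_AE[OF E_nonneg])

lemma w_clock_integrable: "0 \<le> t \<Longrightarrow> integrable M (\<lambda>\<omega>. w j (E t \<omega>) \<omega>)"
  by (rule integrable_of_square_bound(1)[OF w_clock_measurable w_clock_second_moment])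
    (simp_all add: expectation_E_nonneg add_nonneg_nonneg)

text \<open>On a common grid for \<open>E s\<close> and \<open>E t\<close> the identity is exact by \<open>grid_sampling\<close>, and by \<open>w_grid_L2\<close> passing
  to the grid changes both sides by an arbitrarily small amount.\<close>

lemma w_clock_martingale:
  assumes s: "0 \<le> s" and st: "s \<le> t" and A: "A \<in> sets (GG s)"
  shows "(LINT \<omega>:A|M. w j (E t \<omega>) \<omega>) = (LINT \<omega>:A|M. w j (E s \<omega>) \<omega>)"
proof -
  have t: "0 \<le> t"
    using s st by simp
  have A_ev [measurable]: "A \<in> events"
    using A GG_subset[OF s] by auto
  let ?d = "\<lambda>r n \<omega>. w j (grid n (E r \<omega>)) \<omega> - w j (E r \<omega>) \<omega>"
  have d_meas: "?d r n \<in> borel_measurable M" if "0 \<le> r" for r n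
    using that by measurable
  note d = integrable_of_square_bound[OF d_meas w_grid_L2]
  have int_grid: "integrable M (\<lambda>\<omega>. w j (grid n (E r \<omega>)) \<omega>)" if "0 \<le> r" for r n
    using Bochner_Integration.integrable_add[OF d(1)[OF that that, of n] w_clock_integrable[OF that, of j]] by simp
  have set_int: "set_integrable M A f" if "integrable M f" for f :: "'a \<Rightarrow> real"
    using integrable_mult_indicator[OF A_ev that] by (simp add: set_integrable_def)
  have small: "\<bar>LINT \<omega>:A|M. ?d r n \<omega>\<bar> \<le> sqrt (1 / 2 ^ n)" if "0 \<le> r" for r n
  proof -
    have "\<bar>LINT \<omega>:A|M. ?d r n \<omega>\<bar> \<le> (LINT \<omega>:A|M. \<bar>?d r n \<omega>\<bar>)"
      using set_integral_norm_bound[OF set_int[OF d(1)[OF that that, of n]]] by simp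
    also have "\<dots> \<le> expectation (\<lambda>\<omega>. \<bar>?d r n \<omega>\<bar>)"
      unfolding set_lebesgue_integral_def
      using d(1)[OF that that, of n] integrable_mult_indicator[OF A_ev integrable_abs[OF d(1)[OF that that, of n]]]
      by (intro integral_mono) (auto split: split_indicator)
    also have "\<dots> \<le> sqrt (1 / 2 ^ n)"
      using d(3)[OF that that, of n] by simp
    finally show ?thesis .
  qed
  let ?I = "(LINT \<omega>:A|M. w j (E t \<omega>) \<omega>) - (LINT \<omega>:A|M. w j (E s \<omega>) \<omega>)"
  have bound: "\<bar>?I\<bar> \<le> 2 * sqrt (1 / 2 ^ n)" for n
  proof -
    have "AE \<omega> in M. grid n (E s \<omega>) \<le> grid n (E t \<omega>)"
      using E_mono[OF s st] by eventually_elim (rule grid_mono)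
    then have "(LINT \<omega>:A|M. w j (grid n (E t \<omega>)) \<omega> - w j (grid n (E s \<omega>)) \<omega>) = 0"
      by (rule grid_sampling(2)[OF s t A _
            set_int[OF Bochner_Integration.integrable_diff[OF int_grid[OF t] int_grid[OF s]]]])
    then have "(LINT \<omega>:A|M. w j (grid n (E t \<omega>)) \<omega>) = (LINT \<omega>:A|M. w j (grid n (E s \<omega>)) \<omega>)"
      using set_integral_diff(2)[OF set_int[OF int_grid[OF t, of n]] set_int[OF int_grid[OF s, of n]]] by simp
    then have "?I = (LINT \<omega>:A|M. ?d s n \<omega>) - (LINT \<omega>:A|M. ?d t n \<omega>)"
      using set_integral_diff(2)[OF set_int[OF int_grid[OF t, of n]] set_int[OF w_clock_integrable[OF t, of j]]]
        set_integral_diff(2)[OF set_int[OF int_grid[OF s, of n]] set_int[OF w_clock_integrable[OF s, of j]]]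
      by simp
    then show ?thesis
      using small[OF s, of n] small[OF t, of n] by linarith
  qed
  have "(\<lambda>n. 2 * sqrt ((1 / 2) ^ n)) \<longlonglongrightarrow> 2 * sqrt (0 :: real)"
    by (intro tendsto_intros LIMSEQ_power_zero) simp
  then have "\<bar>?I\<bar> \<le> 2 * sqrt (0 :: real)"
    by (rule LIMSEQ_le_const) (use bound in \<open>auto simp: power_one_over\<close>)
  then show ?thesis
    by simp
qed

end

section \<open>The inverse of a stable subordinator\<close>

text \<open>The Laplace transform at \<open>u = 1\<close> turns the expectation into a geometric series. The random series
  quantifies how \<open>U\<close> tends to infinity: it shows that \<open>U\<close> passes the level \<open>t\<close>, and it dominates the
  passage time.\<close>

lemma stable_subordinator_exp_series:
  assumes "prob_space M" and U: "stable_subordinator M \<beta> U"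
  shows "(\<integral>\<^sup>+\<omega>. (\<Sum>n. ennreal (exp (t - U (real n) \<omega>))) \<partial>M) < \<infinity>"
proof -
  have meas: "U \<tau> \<in> borel_measurable M" if "0 \<le> \<tau>" for \<tau>
    using U that by (auto simp: stable_subordinator_def subordinator_def)
  have exp_U: "(\<integral>\<^sup>+\<omega>. ennreal (exp (t - U (real n) \<omega>)) \<partial>M) = ennreal (exp t * exp (- 1) ^ n)" for n
  proof -
    have "\<forall>u\<ge>0. \<forall>\<tau>\<ge>0. (\<integral>\<omega>. exp (- u * U \<tau> \<omega>) \<partial>M) = exp (- \<tau> * u powr \<beta>)"
      using U by (simp add: stable_subordinator_def)
    from this[rule_format, of 1 "real n"]
    have laplace: "(\<integral>\<omega>. exp (- U (real n) \<omega>) \<partial>M) = exp (- real n)"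
      by simp
    then have "integrable M (\<lambda>\<omega>. exp (- U (real n) \<omega>))"
      using not_integrable_integral_eq[of M "\<lambda>\<omega>. exp (- U (real n) \<omega>)"] by fastforce
    then have "integrable M (\<lambda>\<omega>. exp t * exp (- U (real n) \<omega>))"
      by simp
    then have "(\<integral>\<^sup>+\<omega>. ennreal (exp t * exp (- U (real n) \<omega>)) \<partial>M) = ennreal (exp t * exp (- real n))"
      by (subst nn_integral_eq_integral) (auto simp: laplace)
    moreover have "exp (- real n) = exp (- 1) ^ n"
      using exp_of_nat_mult[of n "- 1 :: real"] by simp
    ultimately show ?thesis
      by (simp only: mult_exp_exp diff_conv_add_uminus)
  qed
  have "(\<integral>\<^sup>+\<omega>. (\<Sum>n. ennreal (exp (t - U (real n) \<omega>))) \<partial>M) = (\<Sum>n. ennreal (exp t * exp (- 1) ^ n))"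
    using meas by (subst nn_integral_suminf) (auto simp: exp_U)
  also have "\<dots> = ennreal (\<Sum>n. exp t * exp (- 1) ^ n)"
    by (intro suminf_ennreal2 summable_mult summable_geometric) auto
  finally show ?thesis
    by simp
qed

text \<open>Almost surely the series of the previous lemma converges, so its terms tend to \<open>0\<close>; therefore \<open>U\<close>
  exceeds \<open>t\<close> at some positive integer.\<close>

lemma stable_subordinator_AE_regular:
  assumes "prob_space M" and U: "stable_subordinator M \<beta> U" and "0 \<le> t"
  shows "AE \<omega> in M. mono_on {0..} (\<lambda>\<tau>. U \<tau> \<omega>) \<and> U 0 \<omega> = 0 \<and>
    summable (\<lambda>n. exp (t - U (real n) \<omega>)) \<and> {\<tau>. 0 < \<tau> \<and> t < U \<tau> \<omega>} \<noteq> {}"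
proof -
  have meas: "U \<tau> \<in> borel_measurable M" if "0 \<le> \<tau>" for \<tau>
    using U that by (auto simp: stable_subordinator_def subordinator_def)
  have "AE \<omega> in M. (\<Sum>n. ennreal (exp (t - U (real n) \<omega>))) \<noteq> \<infinity>"
    using meas by (intro nn_integral_PInf_AE less_imp_neq[OF stable_subordinator_exp_series[OF assms(1,2)]]) auto
  moreover have "AE \<omega> in M. U 0 \<omega> = 0" "AE \<omega> in M. mono_on {0..} (\<lambda>\<tau>. U \<tau> \<omega>)"
    using U by (auto simp: stable_subordinator_def subordinator_def)
  ultimately show ?thesis
  proof eventually_elim
    case (elim \<omega>)
    then have summ: "summable (\<lambda>n. exp (t - U (real n) \<omega>))"
      by (intro summable_suminf_not_top) auto
    then have "\<forall>\<^sub>F n in sequentially. exp (t - U (real n) \<omega>) < 1"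
      by (intro order_tendstoD(2)[OF summable_LIMSEQ_zero]) auto
    then obtain n where "0 < n" "exp (t - U (real n) \<omega>) < 1"
      using eventually_conj[OF eventually_gt_at_top[of 0]] eventually_happens'[OF sequentially_bot] by blast
    then have "real n \<in> {\<tau>. 0 < \<tau> \<and> t < U \<tau> \<omega>}"
      by simp
    then show ?case
      using elim summ by blast
  qed
qed

lemma bdd_below_passage: "bdd_below {\<tau>::real. 0 < \<tau> \<and> t < U \<tau> \<omega>}"
  by (rule bdd_belowI[of _ 0]) auto

lemma inverse_stable_subordinator_nonneg:
  assumes "prob_space M" and "stable_subordinator M \<beta> U" and "0 \<le> t"
  shows "AE \<omega> in M. 0 \<le> inverse_subordinator U t \<omega>"
  using stable_subordinator_AE_regular[OF assms]
  by eventually_elim (auto simp: inverse_subordinator_def intro!: cInf_greatest)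

lemma inverse_stable_subordinator_mono:
  assumes "prob_space M" and "stable_subordinator M \<beta> U" and "0 \<le> s" "s \<le> t"
  shows "AE \<omega> in M. inverse_subordinator U s \<omega> \<le> inverse_subordinator U t \<omega>"
proof -
  have "0 \<le> t"
    using assms by simp
  from stable_subordinator_AE_regular[OF assms(1,2) this] show ?thesis
    by eventually_elim
      (use assms(4) in \<open>auto simp: inverse_subordinator_def intro!: cInf_superset_mono bdd_below_passage\<close>)
qed

text \<open>As \<open>U\<close> is increasing, the passage happens before time \<open>r\<close> if and only if \<open>U\<close> exceeds \<open>t\<close> at some
  rational time before \<open>r\<close>. This holds outside a null set, which completeness of \<open>M\<close> permits.\<close>

lemma inverse_stable_subordinator_measurable:
  assumes "prob_space M" and "complete_measure M" and U: "stable_subordinator M \<beta> U" and t: "0 \<le> t"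
  shows "inverse_subordinator U t \<in> borel_measurable M"
proof (rule borel_measurableI_less)
  fix r :: real
  interpret complete_measure M by fact
  have meas: "U \<tau> \<in> borel_measurable M" if "0 \<le> \<tau>" for \<tau>
    using U that by (auto simp: stable_subordinator_def subordinator_def)
  have meas_q: "{\<omega>\<in>space M. t < U q \<omega>} \<in> sets M" if "0 \<le> q" for q
    using meas[OF that] by measurable
  define Q where "Q = {q\<in>\<rat>. 0 < q \<and> q < r}"
  have "countable Q"
    unfolding Q_def by (rule countable_subset[OF _ countable_rat]) auto
  show "{\<omega>\<in>space M. inverse_subordinator U t \<omega> < r} \<in> sets M"
  proof (rule in_sets_AE)
    show "(\<Union>q\<in>Q. {\<omega>\<in>space M. t < U q \<omega>}) \<in> sets M"
      by (rule sets.countable_UN'[OF \<open>countable Q\<close>]) (auto simp: Q_def intro!: meas_q)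
    show "AE \<omega> in M. \<omega> \<in> (\<Union>q\<in>Q. {\<omega>\<in>space M. t < U q \<omega>}) \<longleftrightarrow>
        \<omega> \<in> {\<omega>\<in>space M. inverse_subordinator U t \<omega> < r}"
      using stable_subordinator_AE_regular[OF assms(1) U t] AE_space
    proof eventually_elim
      case (elim \<omega>)
      have "inverse_subordinator U t \<omega> < r \<longleftrightarrow> (\<exists>\<tau>\<in>{\<tau>. 0 < \<tau> \<and> t < U \<tau> \<omega>}. \<tau> < r)"
        unfolding inverse_subordinator_def
        by (rule cInf_less_iff[OF _ bdd_below_passage]) (use elim in auto)
      also have "\<dots> \<longleftrightarrow> (\<exists>q\<in>Q. t < U q \<omega>)"
      proof
        assume "\<exists>\<tau>\<in>{\<tau>. 0 < \<tau> \<and> t < U \<tau> \<omega>}. \<tau> < r"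
        then obtain \<tau> where \<tau>: "0 < \<tau>" "t < U \<tau> \<omega>" "\<tau> < r"
          by auto
        then obtain q where q: "q \<in> \<rat>" "\<tau> < q" "q < r"
          using Rats_dense_in_real by blast
        have "U \<tau> \<omega> \<le> U q \<omega>"
          using elim \<tau> q by (auto dest: mono_onD[of "{0..}" _ \<tau> q])
        then show "\<exists>q\<in>Q. t < U q \<omega>"
          using \<tau> q by (intro bexI[of _ q]) (auto simp: Q_def)
      qed (auto simp: Q_def)
      finally show ?case
        using elim by auto
    qed
  qed auto
qed

text \<open>At every integer \<open>n\<close> before the passage time, \<open>U n \<le> t\<close>, so that the term \<open>exp (t - U n)\<close> is at least \<open>1\<close>.
  Hence the series of these terms is at least the passage time.\<close>

lemma inverse_stable_subordinator_integrable:
  assumes "prob_space M" and "complete_measure M" and U: "stable_subordinator M \<beta> U" and t: "0 \<le> t"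
  shows "integrable M (inverse_subordinator U t)"
proof (rule integrableI_nonneg)
  show "inverse_subordinator U t \<in> borel_measurable M"
    by (rule inverse_stable_subordinator_measurable[OF assms])
  show "AE \<omega> in M. 0 \<le> inverse_subordinator U t \<omega>"
    by (rule inverse_stable_subordinator_nonneg[OF assms(1) U t])
  have "(\<integral>\<^sup>+\<omega>. ennreal (inverse_subordinator U t \<omega>) \<partial>M) \<le> (\<integral>\<^sup>+\<omega>. (\<Sum>n. ennreal (exp (t - U (real n) \<omega>))) \<partial>M)"
  proof (rule nn_integral_mono_AE)
    show "AE \<omega> in M. ennreal (inverse_subordinator U t \<omega>) \<le> (\<Sum>n. ennreal (exp (t - U (real n) \<omega>)))"
      using stable_subordinator_AE_regular[OF assms(1) U t]
    proof eventually_elim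
      case (elim \<omega>)
      let ?E = "inverse_subordinator U t \<omega>"
      \<comment> \<open>The integers from \<open>0\<close> on that are less than the passage time; at \<open>n = 0\<close> the bound comes from
        \<open>U 0 = 0 \<le> t\<close>.\<close>
      define N where "N = nat \<lceil>?E\<rceil>"
      have "1 \<le> exp (t - U (real n) \<omega>)" if "n < N" for n
      proof -
        have "real n < ?E"
          using that unfolding N_def by linarith
        then have "real n \<notin> {\<tau>. 0 < \<tau> \<and> t < U \<tau> \<omega>}"
          using cInf_lower[OF _ bdd_below_passage, of "real n" t U \<omega>]
          by (auto simp: inverse_subordinator_def)
        then show ?thesis
          using elim t by (cases "n = 0") auto
      qed
      then have "(\<Sum>n<N. 1) \<le> (\<Sum>n<N. exp (t - U (real n) \<omega>))"
        by (intro sum_mono) auto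
      also have "\<dots> \<le> (\<Sum>n. exp (t - U (real n) \<omega>))"
        using elim by (intro sum_le_suminf) auto
      finally have "?E \<le> (\<Sum>n. exp (t - U (real n) \<omega>))"
        unfolding N_def by simp linarith
      then have "ennreal ?E \<le> ennreal (\<Sum>n. exp (t - U (real n) \<omega>))"
        by (rule ennreal_leI)
      also have "\<dots> = (\<Sum>n. ennreal (exp (t - U (real n) \<omega>)))"
        using elim by (intro suminf_ennreal2[symmetric]) auto
      finally show ?case .
    qed
  qed
  also have "\<dots> < \<infinity>"
    by (rule stable_subordinator_exp_series[OF assms(1) U])
  finally show "(\<integral>\<^sup>+\<omega>. ennreal (inverse_subordinator U t \<omega>) \<partial>M) < \<infinity>" .
qed

section \<open>The time-changed Wiener process\<close>

lemma (in independent_clock) summable_AE_coefficients: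
  assumes l: "\<And>j. 0 \<le> l j" "summable l" and t: "0 \<le> t"
  shows "AE \<omega> in M. summable (\<lambda>j. (sqrt (l j) * w j (E t \<omega>) \<omega>)\<^sup>2)"
    and "(\<integral>\<^sup>+\<omega>. (\<Sum>j. ennreal ((sqrt (l j) * w j (E t \<omega>) \<omega>)\<^sup>2)) \<partial>M) < \<infinity>"
proof -
  let ?c = "\<lambda>j \<omega>. (sqrt (l j) * w j (E t \<omega>) \<omega>)\<^sup>2"
  have c_meas: "?c j \<in> borel_measurable M" for j
    using t by measurable
  have "(\<integral>\<^sup>+\<omega>. ennreal (?c j \<omega>) \<partial>M) \<le> ennreal (l j * (expectation (E t) + 1))" for j
  proof -
    have w_meas: "(\<lambda>\<omega>. ennreal ((w j (E t \<omega>) \<omega>)\<^sup>2)) \<in> borel_measurable M"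
      using t by measurable
    have "(\<integral>\<^sup>+\<omega>. ennreal (?c j \<omega>) \<partial>M) = ennreal (l j) * (\<integral>\<^sup>+\<omega>. ennreal ((w j (E t \<omega>) \<omega>)\<^sup>2) \<partial>M)"
      using l(1)[of j] by (simp add: nn_integral_cmult[OF w_meas, symmetric] power_mult_distrib ennreal_mult)
    also have "\<dots> \<le> ennreal (l j) * ennreal (expectation (E t) + 1)"
      by (intro mult_left_mono w_clock_second_moment t) simp
    finally show ?thesis
      using l(1)[of j] expectation_E_nonneg[OF t] by (simp add: ennreal_mult)
  qed
  then have "(\<Sum>j. \<integral>\<^sup>+\<omega>. ennreal (?c j \<omega>) \<partial>M) \<le> (\<Sum>j. ennreal (l j * (expectation (E t) + 1)))"
    by (intro suminf_le) auto
  also have "\<dots> = ennreal (\<Sum>j. l j * (expectation (E t) + 1))"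
    using l expectation_E_nonneg[OF t] by (intro suminf_ennreal2 summable_mult2) auto
  also have "\<dots> < \<infinity>"
    by simp
  also have "(\<Sum>j. \<integral>\<^sup>+\<omega>. ennreal (?c j \<omega>) \<partial>M) = (\<integral>\<^sup>+\<omega>. (\<Sum>j. ennreal (?c j \<omega>)) \<partial>M)"
    using c_meas by (intro nn_integral_suminf[symmetric]) simp
  finally show fin: "(\<integral>\<^sup>+\<omega>. (\<Sum>j. ennreal (?c j \<omega>)) \<partial>M) < \<infinity>" .
  have "AE \<omega> in M. (\<Sum>j. ennreal (?c j \<omega>)) \<noteq> \<infinity>"
    using c_meas by (intro nn_integral_PInf_AE less_imp_neq[OF fin]) auto
  then show "AE \<omega> in M. summable (\<lambda>j. ?c j \<omega>)"
  proof eventually_elim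
    case (elim \<omega>)
    then show ?case
      by (intro summable_suminf_not_top) auto
  qed
qed

text \<open>The squared norm of the series is \<open>\<Sum>\<^sub>j l\<^sub>j w\<^sub>j(E\<^sub>t)\<^sup>2\<close>, which is integrable since the eigenvalues are summable.
  A vector is determined by its inner products with the basis, and in these coordinates the martingale
  identity is that of the single Brownian motions.\<close>

lemma (in independent_clock) square_integrable_martingale:
  fixes f :: "nat \<Rightarrow> 'k::{real_inner, banach, second_countable_topology}"
  assumes f: "inj f" "orthonormal_basis (range f)"
    and l: "\<And>j. 0 \<le> l j" "summable l" and "0 \<le> T"
  shows "square_integrable_martingale_upto M T GG (time_change (Q_wiener l w f) E)"
proof -
  let ?X = "time_change (Q_wiener l w f) E"
  let ?c = "\<lambda>j t \<omega>. sqrt (l j) * w j (E t \<omega>) \<omega>"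
  note orth = orthonormal_sequence_inner[OF f]
  have X: "?X t \<omega> = (\<Sum>j. ?c j t \<omega> *\<^sub>R f j)" for t \<omega>
    by (simp add: time_change_def Q_wiener_def)
  have meas_GG: "?X t \<in> borel_measurable (GG t)" if "0 \<le> t" for t
  proof -
    have "(\<lambda>\<omega>. w j (E t \<omega>) \<omega>) \<in> borel_measurable (GG t)" for j
      by (rule w_clock_measurable_GG[OF that])
    then have "(\<lambda>\<omega>. \<Sum>j. ?c j t \<omega> *\<^sub>R f j) \<in> borel_measurable (GG t)"
      by measurable
    then show ?thesis
      by (simp add: X[abs_def])
  qed
  have meas: "?X t \<in> borel_measurable M" if "0 \<le> t" for t
    by (rule subsetD[OF measurable_mono meas_GG[OF that]]) (simp_all add: GG_subset that)
  have square: "integrable M (\<lambda>\<omega>. (norm (?X t \<omega>))\<^sup>2)" if t: "0 \<le> t" for t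
  proof (rule integrableI_nonneg)
    show "(\<lambda>\<omega>. (norm (?X t \<omega>))\<^sup>2) \<in> borel_measurable M"
      using meas[OF t] by measurable
    have "(\<integral>\<^sup>+\<omega>. ennreal ((norm (?X t \<omega>))\<^sup>2) \<partial>M) = (\<integral>\<^sup>+\<omega>. (\<Sum>j. ennreal ((?c j t \<omega>)\<^sup>2)) \<partial>M)"
    proof (rule nn_integral_cong_AE)
      show "AE \<omega> in M. ennreal ((norm (?X t \<omega>))\<^sup>2) = (\<Sum>j. ennreal ((?c j t \<omega>)\<^sup>2))"
        using summable_AE_coefficients(1)[of l, OF l t]
      proof eventually_elim
        case (elim \<omega>)
        show ?case
          unfolding X orthonormal_series(3)[OF orth elim]
          by (rule suminf_ennreal2[symmetric, OF _ elim]) simp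
      qed
    qed
    then show "(\<integral>\<^sup>+\<omega>. ennreal ((norm (?X t \<omega>))\<^sup>2) \<partial>M) < \<infinity>"
      using summable_AE_coefficients(2)[of l, OF l t] by simp
  qed auto
  have int: "integrable M (?X t)" if "0 \<le> t" for t
  proof -
    have "integrable M (\<lambda>\<omega>. norm (?X t \<omega>))"
      by (rule square_integrable_imp_integrable[OF measurable_compose[OF meas[OF that] borel_measurable_norm] square[OF that]])
    then show ?thesis
      by (rule integrable_norm_iff[OF meas[OF that], THEN iffD1])
  qed
  have inner: "(LINT \<omega>:A|M. ?X t \<omega>) \<bullet> f k = sqrt (l k) * (LINT \<omega>:A|M. w k (E t \<omega>) \<omega>)"
    if t: "0 \<le> t" and A: "A \<in> events" for t A k
  proof -
    have "(LINT \<omega>:A|M. ?X t \<omega>) \<bullet> f k = (\<integral>\<omega>. (indicator A \<omega> *\<^sub>R ?X t \<omega>) \<bullet> f k \<partial>M)"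
      unfolding set_lebesgue_integral_def
      using integrable_mult_indicator[OF A int[OF t]] by (intro integral_inner_left[symmetric])
    also have "\<dots> = (\<integral>\<omega>. sqrt (l k) * (indicator A \<omega> *\<^sub>R w k (E t \<omega>) \<omega>) \<partial>M)"
    proof (rule integral_cong_AE)
      show "AE \<omega> in M. (indicator A \<omega> *\<^sub>R ?X t \<omega>) \<bullet> f k = sqrt (l k) * (indicator A \<omega> *\<^sub>R w k (E t \<omega>) \<omega>)"
        using summable_AE_coefficients(1)[of l, OF l t]
      proof eventually_elim
        case (elim \<omega>)
        show ?case
          unfolding X inner_scaleR_left orthonormal_series(2)[OF orth elim] by simp
      qed
    qed (use A meas[OF t] t in measurable)
    finally show ?thesis
      by (simp add: set_lebesgue_integral_def)
  qed
  have mart: "(LINT \<omega>:A|M. ?X s \<omega>) = (LINT \<omega>:A|M. ?X t \<omega>)"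
    if s: "0 \<le> s" and st: "s \<le> t" and A: "A \<in> sets (GG s)" for s t A
  proof (rule eq_if_inner_orthonormal_basis_eq[OF f(2)])
    have "A \<in> events" "0 \<le> t"
      using A GG_subset[OF s] s st by auto
    then show "(LINT \<omega>:A|M. ?X s \<omega>) \<bullet> f k = (LINT \<omega>:A|M. ?X t \<omega>) \<bullet> f k" for k
      using s by (simp add: inner w_clock_martingale[OF s st A])
  qed
  have "filtration_upto M T GG"
    using GG_subset GG_mono by (auto simp: filtration_upto_def subalgebra_def)
  moreover have "\<exists>Y. is_cond_exp M (GG s) (?X t) Y \<and> (AE \<omega> in M. Y \<omega> = ?X s \<omega>)"
    if "0 \<le> s" "s \<le> t" for s t
    using that int meas_GG mart by (intro exI[of _ "?X s"]) (auto simp: is_cond_exp_def)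
  ultimately show ?thesis
    using meas_GG int square[OF \<open>0 \<le> T\<close>]
    by (auto simp: square_integrable_martingale_upto_def martingale_upto_def)
qed

theorem theorem2p6:
  fixes M :: "'a measure"
    and Q :: "'k::{real_inner, banach, second_countable_topology} \<Rightarrow> 'k"
    and f :: "nat \<Rightarrow> 'k"
    and l :: "nat \<Rightarrow> real"
    and w :: "nat \<Rightarrow> real \<Rightarrow> 'a \<Rightarrow> real"
    and U E :: "real \<Rightarrow> 'a \<Rightarrow> real"
    and \<beta> T :: real
  assumes "prob_space M" and "complete_measure M"
    and "nonneg_definite Q" and "symmetric_op Q" and "trace_class Q"
    and "inj f" and "orthonormal_basis (range f)"
    and "\<And>j. Q (f j) = l j *\<^sub>R f j"
    and "\<And>j. standard_brownian_motion M (w j)"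
    and "independent_processes M w"
    and "0 < \<beta>" and "\<beta> < 1"
    and "stable_subordinator M \<beta> U"
    and "E = inverse_subordinator U"
    and "family_independent_of M w E"
    and "0 < T"
  shows "square_integrable_martingale_upto M T (time_changed_filtration M w E)
           (time_change (Q_wiener l w f) E)"
proof -
  have "norm (f j) = 1" for j
    using assms(7) by (auto simp: orthonormal_basis_def)
  then have l_nonneg: "0 \<le> l j" for j
    using nonneg_definite_eigenvalue_nonneg[OF assms(3) assms(8)] by blast
  have l_summable: "summable l"
    by (rule trace_class_eigenvalues_summable[OF assms(3-8)])
  note clock = inverse_stable_subordinator_nonneg[OF assms(1,13)]
    inverse_stable_subordinator_mono[OF assms(1,13)]
    inverse_stable_subordinator_measurable[OF assms(1,2,13)]
    inverse_stable_subordinator_integrable[OF assms(1,2,13)]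
  have "independent_clock M w E"
    using assms(1,2,9,10,15) clock unfolding assms(14)
    by (intro independent_clock.intro independent_clock_axioms.intro)
  then show ?thesis
    by (rule independent_clock.square_integrable_martingale[OF _ assms(6,7) l_nonneg l_summable])
      (use assms(16) in simp)
qed

end
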